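(* Let $k=(k_1,\dots,k_l)\in\mathbb{Z}_+^l$ be a partition of $n$. For every $j=0,\dots,l$, the $H_j$-action on $V_j$ descends to an action on $G_j\backslash V_j$ so that the $H_j$-action defines an automorphism of the principal bundle $\pi_j:V_j\to G_j\backslash V_j$. In particular, the $H_j$-action maps fibers of $\pi_j$ onto fibers of $\pi_j$. Furthermore, the $(H_j\cap\mathcal{T})$-action maps the Lagrangian frames $(\mathcal{O}_F,\mathcal{JO}_F)$ of the fibers $F$ of $\pi_j$ into the corresponding Lagrangian frames.
   Context: A partition of $n$ is $k=(k_1,\dots,k_l)$ with positive integer entries, $k_1\le\dots\le k_l$, $k_1+\dots+k_l=n$; $\mathbb{T}$ is the unit circle. $\mathbb{P}^n(\mathbb{C})$ carries the Fubini–Study Kähler structure; complex submanifolds carry the restricted Kähler structure. $\mathrm{PSL}(n+1,\mathbb{C})=\mathrm{SL}(n+1,\mathbb{C})/(\mathbb{T}I_{n+1}\cap\mathrm{SL}(n+1,\mathbb{C}))$, $[A]$ is the class of $A$, acting by $[A][w]=[Aw]$. Write $w\in\mathbb{C}^{n+1}=\mathbb{C}\times\mathbb{C}^{k_1}\times\dots\times\mathbb{C}^{k_l}$ as $w=(w_0=w_{(0)},w_{(1)},\dots,w_{(l)})$. $V_0=\{[w]: w_0,w_{(1)},\dots,w_{(l)}\ne0\}$ and, for $j=1,\dots,l$, $V_j=\{[w]: w_{(j)},\dots,w_{(l)}\neq0,\ w_0=0,\dots,w_{(j-1)}=0\}$. $G_0$ is the group of classes $[A]$ with $A$ block diagonal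 with blocks $(z_0,z_1I_{k_1},\dots,z_lI_{k_l})$, $z_i\in\mathbb{C}^*$, $z_0z_1^{k_1}\cdots z_l^{k_l}=1$. For $j=1,\dots,l$, $G_j\subset G_0$ is the subgroup of classes of block diagonal matrices with blocks $(z_0,I_{k_1},\dots,I_{k_{j-1}},z_jI_{k_j},\dots,z_lI_{k_l})$, $z_0,z_j,\dots,z_l\in\mathbb{C}^*$, $z_0z_j^{k_j}\cdots z_l^{k_l}=1$. $\mathcal{T}_k$ is the group of classes of block diagonal matrices with blocks $(\overline{t}_1^{k_1}\cdots\overline{t}_l^{k_l},t_1I_{k_1},\dots,t_lI_{k_l})$, $t_i\in\mathbb{T}$, and $\mathcal{T}_j=G_j\cap\mathcal{T}_k$. $\mathcal{T}$ is the group of classes $[D]$ with $D\in\mathrm{SU}(n+1)$ diagonal. The natural quotient map $\pi_j:V_j\to G_j\backslash V_j$ is taken as a smooth complex principal fiber bundle with structure group $G_j\simeq(\mathbb{C}^* )^{l-j+1}$, whose fibers are the $G_j$-orbits in $V_j$; "automorphism of a principal bundle" has its usual meaning. For $j=0,\dots,l$, $H_j$ is the subgroup of $\mathrm{PSL}(n+1,\mathbb{C})$ of classes $[D]$ with $D$ block diagonal with blocks $(1,I_{k_1},\dots,I_{k_{j-1}},D_j,\dots,D_l)$, where each $D_r$ is a diagonal $k_r\times k_r$ matrix with $\det D_r=1$ (for $j=0$ and $j=1$ the blocks are $(1,D_1,\dots,D_l)$). For a fiber $F$ of $\pi_j$, $\mathcal{O}_F$ is the foliation of $F$ by $\mathcal{T}_j$-orbits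 and $\mathcal{JO}_F$ is the foliation of $F$ integrating the orthogonal complement of $T\mathcal{O}_F$ in $TF$. The pair $(\mathcal{O}_F,\mathcal{JO}_F)$ is a Lagrangian frame of $F$: two Lagrangian foliations, mutually orthogonal, the first Riemannian and the second totally geodesic. *)

theory Defs
  imports "HOL-Analysis.Analysis" "HOL-Algebra.Group_Action"
begin

type_synonym 'i cvec = "(complex, 'i) vec"
type_synonym 'i cmat = "((complex, 'i) vec, 'i) vec"


section \<open>Partitions and blocks of coordinates\<close>

definition is_partition :: "nat list \<Rightarrow> nat \<Rightarrow> bool" where
  "is_partition k n \<longleftrightarrow> sorted k \<and> (\<forall>m\<in>set k. 0 < m) \<and> sum_list k = n"

text \<open>The coordinates of \<open>\<complex>\<^sup>n\<^sup>+\<^sup>1\<close> are indexed by a linearly ordered type with \<open>n + 1\<close> elements, so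
  \<open>index_rank\<close> is the enumeration by \<open>0, \<dots>, n\<close>. Ranks \<open>0\<close>, \<open>1..k\<^sub>1\<close>, \<open>k\<^sub>1+1..k\<^sub>1+k\<^sub>2\<close>, ... form the blocks
  \<open>0\<close>, \<open>1\<close>, \<open>2\<close>, ...; the entry \<open>k\<^sub>r\<close> of the partition is \<open>k ! (r - 1)\<close>.\<close>

definition index_rank :: "'i::{finite,linorder} \<Rightarrow> nat" where
  "index_rank i = card {a. a < i}"

definition block :: "nat list \<Rightarrow> 'i::{finite,linorder} \<Rightarrow> nat" where
  "block k i = (LEAST r. index_rank i \<le> sum_list (take r k))"

definition block_comp :: "nat list \<Rightarrow> nat \<Rightarrow> 'i::{finite,linorder} cvec \<Rightarrow> 'i cvec" where
  "block_comp k r w = (\<chi> i. if block k i = r then w $ i else 0)"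

definition diag_matrix :: "('i::finite \<Rightarrow> complex) \<Rightarrow> 'i cmat" where
  "diag_matrix d = (\<chi> a b. if a = b then d a else 0)"

definition block_scalar :: "nat list \<Rightarrow> (nat \<Rightarrow> complex) \<Rightarrow> 'i::{finite,linorder} cmat" where
  "block_scalar k z = diag_matrix (\<lambda>i. z (block k i))"


section \<open>The projective linear group and its subgroups\<close>

definition SL :: "('i::finite cmat) monoid" where
  "SL = \<lparr>carrier = {A. det A = 1}, mult = (**), one = mat 1\<rparr>"

definition SL_center :: "'i::finite cmat set" where
  "SL_center = {mat c | c. norm c = 1 \<and> det (mat c :: 'i cmat) = 1}"

definition PSL :: "'i::finite cmat set monoid" where
  "PSL = SL Mod SL_center"

definition psl_class :: "'i::finite cmat \<Rightarrow> 'i cmat set" where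
  "psl_class A = SL_center #>\<^bsub>SL\<^esub> A"

abbreviation PSL_sub :: "'i::finite cmat set set \<Rightarrow> 'i cmat set monoid" where
  "PSL_sub H \<equiv> PSL\<lparr>carrier := H\<rparr>"

definition G_grp :: "nat list \<Rightarrow> nat \<Rightarrow> 'i::{finite,linorder} cmat set set" where
  "G_grp k j = {psl_class (block_scalar k z) | z.
      (\<forall>r\<le>length k. z r \<noteq> 0) \<and>
      z 0 * (\<Prod>r=1..length k. z r ^ (k ! (r - 1))) = 1 \<and>
      (\<forall>r. 1 \<le> r \<and> r < j \<longrightarrow> z r = 1)}"

definition T_k_grp :: "nat list \<Rightarrow> 'i::{finite,linorder} cmat set set" where
  "T_k_grp k = {psl_class (block_scalar k (\<lambda>r. if r = 0
        then (\<Prod>s=1..length k. cnj (t s) ^ (k ! (s - 1))) else t r)) | t.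
      \<forall>r\<in>{1..length k}. norm (t r) = 1}"

definition T_j_grp :: "nat list \<Rightarrow> nat \<Rightarrow> 'i::{finite,linorder} cmat set set" where
  "T_j_grp k j = G_grp k j \<inter> T_k_grp k"

definition T_grp :: "'i::finite cmat set set" where
  "T_grp = {psl_class (diag_matrix d) | d.
      det (diag_matrix d) = 1 \<and>
      diag_matrix d ** transpose (map_matrix cnj (diag_matrix d)) = mat 1}"

text \<open>The product is the determinant of the \<open>r\<close>-th (diagonal) block.\<close>

definition H_grp :: "nat list \<Rightarrow> nat \<Rightarrow> 'i::{finite,linorder} cmat set set" where
  "H_grp k j = {psl_class (diag_matrix d) | d.
      (\<forall>i. block k i = 0 \<or> block k i < j \<longrightarrow> d i = 1) \<and>
      (\<forall>r. 1 \<le> r \<and> j \<le> r \<and> r \<le> length k \<longrightarrow> (\<Prod>i | block k i = r. d i) = 1)}"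


section \<open>Projective space\<close>

text \<open>The point \<open>[w]\<close> is the punctured line through \<open>w\<close>.\<close>

definition proj :: "'i::finite cvec \<Rightarrow> 'i cvec set" where
  "proj w = {c *s w | c. c \<noteq> 0}"

text \<open>A class of matrices differing by scalars maps a punctured line to a punctured line, so that
  \<open>psl_act [A] [w] = [A w]\<close>.\<close>

definition psl_act :: "'i::finite cmat set \<Rightarrow> 'i cvec set \<Rightarrow> 'i cvec set" where
  "psl_act X p = {A *v w | A w. A \<in> X \<and> w \<in> p}"

text \<open>A complex structure on a set of points is given by the topology and, for each open set, the
  holomorphic functions on it (only their values on that open set matter).\<close>

record 'p complex_space =
  ctop :: "'p topology"
  chol :: "'p set \<Rightarrow> ('p \<Rightarrow> complex) set"

definition holomorphic_multi :: "'i::finite cvec set \<Rightarrow> ('i cvec \<Rightarrow> complex) \<Rightarrow> bool" where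
  "holomorphic_multi S f \<longleftrightarrow> open S \<and>
     (\<forall>w\<in>S. \<exists>L. (f has_derivative L) (at w) \<and> (\<forall>c v. L (c *s v) = c * L v))"

text \<open>\<open>\<P>\<^sup>n\<close> as the quotient of \<open>\<complex>\<^sup>n\<^sup>+\<^sup>1 - {0}\<close> by \<open>\<complex>\<^sup>*\<close>.\<close>

definition proj_space :: "'i::finite cvec set complex_space" where
  "proj_space = \<lparr>
     ctop = topology (\<lambda>U. U \<subseteq> proj ` (- {0}) \<and> open {w. w \<noteq> 0 \<and> proj w \<in> U}),
     chol = (\<lambda>U. {f. holomorphic_multi {w. w \<noteq> 0 \<and> proj w \<in> U} (\<lambda>w. f (proj w))})\<rparr>"

text \<open>Induced structure of a complex submanifold: holomorphic functions are those that extend locally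
  to holomorphic functions of the ambient manifold.\<close>

definition sub_space :: "'p complex_space \<Rightarrow> 'p set \<Rightarrow> 'p complex_space" where
  "sub_space X S = \<lparr>
     ctop = subtopology (ctop X) S,
     chol = (\<lambda>U. {f. \<forall>p\<in>U. \<exists>W g. openin (ctop X) W \<and> p \<in> W \<and> g \<in> chol X W \<and>
                        (\<forall>q\<in>W \<inter> U. f q = g q)})\<rparr>"

text \<open>Quotient structure along \<open>\<pi>\<close>; this is the only complex structure on the base for which \<open>\<pi>\<close> is the
  projection of a holomorphic principal bundle.\<close>

definition quotient_space :: "'p complex_space \<Rightarrow> ('p \<Rightarrow> 'b) \<Rightarrow> 'b complex_space" where
  "quotient_space X \<pi> = \<lparr>
     ctop = topology (\<lambda>U. U \<subseteq> \<pi> ` topspace (ctop X) \<and>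
                          openin (ctop X) {p \<in> topspace (ctop X). \<pi> p \<in> U}),
     chol = (\<lambda>U. {f. f \<circ> \<pi> \<in> chol X {p \<in> topspace (ctop X). \<pi> p \<in> U}})\<rparr>"

definition holomorphic_mapping ::
    "'p complex_space \<Rightarrow> 'q complex_space \<Rightarrow> ('p \<Rightarrow> 'q) \<Rightarrow> bool" where
  "holomorphic_mapping X Y f \<longleftrightarrow> continuous_map (ctop X) (ctop Y) f \<and>
     (\<forall>U g. openin (ctop Y) U \<and> g \<in> chol Y U \<longrightarrow>
        g \<circ> f \<in> chol X {p \<in> topspace (ctop X). f p \<in> U})"

definition biholomorphic_mapping ::
    "'p complex_space \<Rightarrow> 'q complex_space \<Rightarrow> ('p \<Rightarrow> 'q) \<Rightarrow> bool" where
  "biholomorphic_mapping X Y f \<longleftrightarrow> holomorphic_mapping X Y f \<and>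
     (\<exists>g. holomorphic_mapping Y X g \<and>
        (\<forall>p\<in>topspace (ctop X). g (f p) = p) \<and> (\<forall>q\<in>topspace (ctop Y). f (g q) = q))"


section \<open>The bundles \<open>V\<^sub>j \<rightarrow> V\<^sub>j / G\<^sub>j\<close>\<close>

definition V_set :: "nat list \<Rightarrow> nat \<Rightarrow> 'i::{finite,linorder} cvec set set" where
  "V_set k j = {proj w | w. w \<noteq> 0 \<and> (\<forall>r<j. block_comp k r w = 0) \<and>
      (\<forall>r\<in>{j..length k}. block_comp k r w \<noteq> 0)}"

definition V_space :: "nat list \<Rightarrow> nat \<Rightarrow> 'i::{finite,linorder} cvec set complex_space" where
  "V_space k j = sub_space proj_space (V_set k j)"

definition bundle_proj ::
    "nat list \<Rightarrow> nat \<Rightarrow> 'i::{finite,linorder} cvec set \<Rightarrow> 'i cvec set set" where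
  "bundle_proj k j p = orbit (PSL_sub (G_grp k j)) psl_act p"

definition base_set :: "nat list \<Rightarrow> nat \<Rightarrow> 'i::{finite,linorder} cvec set set set" where
  "base_set k j = orbits (PSL_sub (G_grp k j)) (V_set k j) psl_act"

definition base_space ::
    "nat list \<Rightarrow> nat \<Rightarrow> 'i::{finite,linorder} cvec set set complex_space" where
  "base_space k j = quotient_space (V_space k j) (bundle_proj k j)"

definition fibers :: "nat list \<Rightarrow> nat \<Rightarrow> 'i::{finite,linorder} cvec set set set" where
  "fibers k j = {{p \<in> V_set k j. bundle_proj k j p = b} | b. b \<in> base_set k j}"

text \<open>\<open>f\<close> is an automorphism, covering \<open>f'\<close>, of the bundle \<open>\<pi> : P \<rightarrow> B\<close> whose structure group \<open>G\<close> acts on \<open>P\<close>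
  by \<open>\<rho>\<close>.\<close>

definition principal_bundle_automorphism ::
    "'p complex_space \<Rightarrow> 'b complex_space \<Rightarrow> ('p \<Rightarrow> 'b) \<Rightarrow> 'g set \<Rightarrow> ('g \<Rightarrow> 'p \<Rightarrow> 'p) \<Rightarrow>
      ('p \<Rightarrow> 'p) \<Rightarrow> ('b \<Rightarrow> 'b) \<Rightarrow> bool" where
  "principal_bundle_automorphism P B \<pi> G \<rho> f f' \<longleftrightarrow>
     biholomorphic_mapping P P f \<and> biholomorphic_mapping B B f' \<and>
     (\<forall>p\<in>topspace (ctop P). \<pi> (f p) = f' (\<pi> p)) \<and>
     (\<forall>g\<in>G. \<forall>p\<in>topspace (ctop P). f (\<rho> g p) = \<rho> g (f p))"


section \<open>Tangent vectors and the Fubini--Study metric\<close>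

text \<open>\<open>C\<^sup>m\<close> and \<open>C\<^sup>\<infinity>\<close> maps on an open set, via iterated directional derivatives.\<close>

primrec Cm_on :: "nat \<Rightarrow> 'a::real_normed_vector set \<Rightarrow> ('a \<Rightarrow> 'b::real_normed_vector) \<Rightarrow> bool" where
  "Cm_on 0 S f \<longleftrightarrow> continuous_on S f"
| "Cm_on (Suc m) S f \<longleftrightarrow> (\<forall>x\<in>S. f differentiable (at x)) \<and>
     (\<forall>v. Cm_on m S (\<lambda>x. frechet_derivative f (at x) v))"

definition Cinf_on :: "'a::real_normed_vector set \<Rightarrow> ('a \<Rightarrow> 'b::real_normed_vector) \<Rightarrow> bool" where
  "Cinf_on S f \<longleftrightarrow> (\<forall>m. Cm_on m S f)"

text \<open>The tangent vector of \<open>\<P>\<^sup>n\<close> at \<open>[w]\<close> that is the image of \<open>u \<in> T\<^sub>w(\<complex>\<^sup>n\<^sup>+\<^sup>1 - {0})\<close> under the differential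
  of \<open>proj\<close>, encoded as the set of all pairs \<open>(w', u')\<close> with that image.\<close>

definition tvec :: "'i::finite cvec \<Rightarrow> 'i cvec \<Rightarrow> ('i cvec \<times> 'i cvec) set" where
  "tvec w u = {(c *s w, c *s u + b *s w) | c b. c \<noteq> 0}"

definition hinner :: "'i::finite cvec \<Rightarrow> 'i cvec \<Rightarrow> complex" where
  "hinner u v = (\<Sum>i\<in>UNIV. u $ i * cnj (v $ i))"

text \<open>Only meaningful for tangent vectors at the same point, where the value does not depend on the
  representatives. The normalization constant of the metric is immaterial for orthogonality.\<close>

definition fs_metric ::
    "('i::finite cvec \<times> 'i cvec) set \<Rightarrow> ('i cvec \<times> 'i cvec) set \<Rightarrow> real" where
  "fs_metric X Y = (THE r. \<exists>w u v. w \<noteq> 0 \<and> X = tvec w u \<and> Y = tvec w v \<and>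
     r = Re (hinner u v) / (norm w)^2 - Re (hinner u w * hinner w v) / (norm w)^4)"

text \<open>Velocities at \<open>p\<close> of smooth curves inside an embedded submanifold \<open>S\<close> of \<open>\<P>\<^sup>n\<close>; a curve is given by
  a lift to \<open>\<complex>\<^sup>n\<^sup>+\<^sup>1 - {0}\<close>.\<close>

definition tangent_space ::
    "'i::finite cvec set set \<Rightarrow> 'i cvec set \<Rightarrow> ('i cvec \<times> 'i cvec) set set" where
  "tangent_space S p = {tvec (c 0) (vector_derivative c (at 0)) | c e.
      0 < e \<and> Cinf_on {-e<..<e::real} c \<and>
      (\<forall>t\<in>{-e<..<e}. c t \<noteq> 0 \<and> proj (c t) \<in> S) \<and> proj (c 0) = p}"


section \<open>Foliations\<close>

text \<open>\<open>L \<subseteq> F\<close> is a connected integral manifold of the distribution \<open>D\<close> on \<open>F\<close>: with its own manifold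
  topology \<open>\<tau>\<close> it is an immersed submanifold whose tangent spaces are given by \<open>D\<close>. Local parametrizations
  are defined on open subsets \<open>S \<inter> E\<close> of a real vector space \<open>E\<close>, and \<open>\<psi>\<close> is a lift to \<open>\<complex>\<^sup>n\<^sup>+\<^sup>1 - {0}\<close>. It is
  no restriction to take \<open>E\<close> inside \<open>\<complex>\<^sup>n\<^sup>+\<^sup>1\<close>, whose dimension is large enough, and \<open>\<psi>\<close> smooth on an open
  subset \<open>S\<close> of \<open>\<complex>\<^sup>n\<^sup>+\<^sup>1\<close> (compose with the orthogonal projection onto \<open>E\<close>).\<close>

definition integral_manifold ::
    "'i::finite cvec set set \<Rightarrow> ('i cvec set \<Rightarrow> ('i cvec \<times> 'i cvec) set set) \<Rightarrow>
      'i cvec set set \<Rightarrow> bool" where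
  "integral_manifold F D L \<longleftrightarrow> L \<subseteq> F \<and> L \<noteq> {} \<and>
     (\<exists>\<tau>. topspace \<tau> = L \<and> connected_space \<tau> \<and> Hausdorff_space \<tau> \<and> second_countable \<tau> \<and>
        (\<forall>p\<in>L. \<exists>W E S \<psi>.
           openin \<tau> W \<and> p \<in> W \<and> subspace E \<and> open S \<and>
           Cinf_on S \<psi> \<and> (\<forall>x\<in>S. \<psi> x \<noteq> 0) \<and>
           homeomorphic_map (top_of_set (S \<inter> E)) (subtopology \<tau> W) (proj \<circ> \<psi>) \<and>
           (\<forall>x\<in>S \<inter> E.
              inj_on (\<lambda>v. tvec (\<psi> x) (frechet_derivative \<psi> (at (x::'i cvec)) v)) E \<and>
              (\<lambda>v. tvec (\<psi> x) (frechet_derivative \<psi> (at x) v)) ` E = D (proj (\<psi> x)))))"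

text \<open>The foliation integrating \<open>D\<close>, given by its set of leaves.\<close>

definition integral_foliation ::
    "'i::finite cvec set set \<Rightarrow> ('i cvec set \<Rightarrow> ('i cvec \<times> 'i cvec) set set) \<Rightarrow>
      'i cvec set set set" where
  "integral_foliation F D = {L. integral_manifold F D L \<and>
     (\<forall>L'. integral_manifold F D L' \<and> L \<subseteq> L' \<longrightarrow> L' = L)}"

definition orbit_foliation ::
    "nat list \<Rightarrow> nat \<Rightarrow> 'i::{finite,linorder} cvec set set \<Rightarrow> 'i cvec set set set" where
  "orbit_foliation k j F = orbits (PSL_sub (T_j_grp k j)) F psl_act"

definition normal_distribution ::
    "nat list \<Rightarrow> nat \<Rightarrow> 'i::{finite,linorder} cvec set set \<Rightarrow>
      'i cvec set \<Rightarrow> ('i cvec \<times> 'i cvec) set set" where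
  "normal_distribution k j F p = {X \<in> tangent_space F p.
     \<forall>Y \<in> tangent_space (orbit (PSL_sub (T_j_grp k j)) psl_act p) p. fs_metric X Y = 0}"

definition normal_foliation ::
    "nat list \<Rightarrow> nat \<Rightarrow> 'i::{finite,linorder} cvec set set \<Rightarrow> 'i cvec set set set" where
  "normal_foliation k j F = integral_foliation F (normal_distribution k j F)"

end

theory Submission
  imports Defs
begin

text \<open>
  All groups involved consist of classes of diagonal matrices with nonzero entries. Two elementary facts
  about such a class \<open>h\<close> give the statements on the bundle. It rescales coordinates, so it preserves the
  pattern of vanishing blocks and maps \<open>V\<^sub>j\<close> to itself; and it commutes with \<open>G\<^sub>j\<close>, so it maps the \<open>G\<^sub>j\<close>-orbit of
  \<open>p\<close> onto that of \<open>h p\<close> (\<open>orbit_psl_act_diag\<close>). Hence \<open>h\<close> is equivariant, maps fibers onto fibers and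
  induces the map \<open>b \<mapsto> h(b)\<close> of the set of orbits. On \<open>V\<^sub>j\<close> the map \<open>h\<close> is holomorphic because it lifts to a
  linear map (\<open>holomorphic_mapping_psl_act\<close>), on the base because the complex structure there is the quotient
  structure (\<open>holomorphic_mapping_quotient_space\<close>), and the inverse of \<open>h\<close> is a map of the same kind. So \<open>h\<close> is
  an automorphism of the bundle (\<open>principal_bundle_automorphism_diag\<close>). The \<open>H\<^sub>j\<close> are groups since
  block determinants are multiplicative, and they act on the base through images of orbits.

  For the Lagrangian frames, \<open>h\<close> also commutes with \<open>\<T>\<^sub>j\<close>, so it permutes the \<open>\<T>\<^sub>j\<close>-orbits
  (\<open>orbit_foliation_image\<close>). If \<open>h\<close> is moreover represented by a unitary matrix \<open>A\<close>, then its differential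
  \<open>(w, u) \<mapsto> (A w, A u)\<close> preserves the Fubini--Study metric (\<open>fs_metric_proj_deriv\<close>) and hence carries the
  orthogonal complement of the orbit directions in a fiber to the one in the image fiber
  (\<open>normal_distribution_image\<close>). Composing parametrizations with \<open>A\<close> turns integral manifolds of the one
  distribution into integral manifolds of the other (\<open>integral_manifold_image\<close>). The same holds for the
  inverse of \<open>A\<close>, so maximal ones correspond to maximal ones (\<open>integral_foliation_image\<close>).
\<close>


section \<open>The projective action of matrices\<close>

lemma mat_matrix_mult: "(mat c :: 'i::finite cmat) ** A = (\<chi> a b. c * A $ a $ b)"
  by (simp add: matrix_matrix_mult_def mat_def vec_eq_iff if_distrib[of "\<lambda>x. x * _"] cong: if_cong)

lemma matrix_mult_mat: "A ** (mat c :: 'i::finite cmat) = (\<chi> a b. c * A $ a $ b)"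
  by (simp add: matrix_matrix_mult_def mat_def vec_eq_iff if_distrib[of "\<lambda>x. _ * x"] mult.commute
      cong: if_cong)

lemma mat_vector_mult: "(mat c :: 'i::finite cmat) *v w = c *s w"
  by (simp add: matrix_vector_mult_def mat_def vec_eq_iff if_distrib[of "\<lambda>x. x * _"] cong: if_cong)

lemma psl_class_altdef: "psl_class A = {mat c ** A | c. norm c = 1 \<and> det (mat c :: 'i cmat) = 1}"
  for A :: "'i::finite cmat"
  by (auto simp: psl_class_def r_coset_def SL_center_def SL_def)

lemma mem_psl_class: "(A :: 'i::finite cmat) \<in> psl_class A"
  unfolding psl_class_altdef by (rule CollectI, rule exI[of _ 1]) simp

lemma SL_center_eq_psl_class: "SL_center = psl_class (mat 1 :: 'i::finite cmat)"
  by (simp add: psl_class_altdef SL_center_def)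

lemma psl_class_mult: "psl_class A <#>\<^bsub>SL\<^esub> psl_class B = psl_class (A ** B)"
  for A B :: "'i::finite cmat"
proof
  have "(mat c ** A) ** (mat c' ** B) \<in> psl_class (A ** B)"
    if "norm c = 1" "det (mat c :: 'i cmat) = 1" "norm c' = 1" "det (mat c' :: 'i cmat) = 1" for c c'
  proof -
    have "(mat c :: 'i cmat) ** mat c' = mat (c * c')"
      by (simp add: mat_matrix_mult vec_eq_iff) (simp add: mat_def)
    moreover have "(mat c ** A) ** (mat c' ** B) = (mat c ** mat c') ** (A ** B)"
      by (metis mat_matrix_mult matrix_mult_mat matrix_mul_assoc)
    ultimately have "(mat c ** A) ** (mat c' ** B) = mat (c * c') ** (A ** B)"
      and "det (mat (c * c') :: 'i cmat) = 1"
      using that det_mul[of "mat c :: 'i cmat" "mat c'"] by simp_all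
    with that show ?thesis
      unfolding psl_class_altdef by (auto simp: norm_mult)
  qed
  then show "psl_class A <#>\<^bsub>SL\<^esub> psl_class B \<subseteq> psl_class (A ** B)"
    by (auto simp: set_mult_def SL_def psl_class_altdef[of A] psl_class_altdef[of B])
  have "mat c ** (A ** B) \<in> psl_class A <#>\<^bsub>SL\<^esub> psl_class B"
    if "norm c = 1" "det (mat c :: 'i cmat) = 1" for c
  proof -
    have "mat c ** A \<in> psl_class A" using that by (auto simp: psl_class_altdef)
    then show ?thesis
      using mem_psl_class[of B] matrix_mul_assoc[of "mat c" A B]
      by (auto simp: set_mult_def SL_def)
  qed
  then show "psl_class (A ** B) \<subseteq> psl_class A <#>\<^bsub>SL\<^esub> psl_class B"
    by (auto simp: psl_class_altdef[of "A ** B"])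
qed

text \<open>Multiplication of classes is multiplication of representatives, so the group axioms are inherited from
  those of matrices. This is how the groups \<open>H\<^sub>j\<close> are recognised as groups.\<close>

lemma group_PSL_sub:
  fixes M :: "'i::finite cmat set"
  assumes one: "mat 1 \<in> M"
    and mult: "\<And>A B. A \<in> M \<Longrightarrow> B \<in> M \<Longrightarrow> A ** B \<in> M"
    and inverse: "\<And>A. A \<in> M \<Longrightarrow> \<exists>B\<in>M. B ** A = mat 1"
  shows "group (PSL_sub (psl_class ` M))"
proof (rule groupI)
  show "x \<otimes>\<^bsub>PSL_sub (psl_class ` M)\<^esub> y \<in> carrier (PSL_sub (psl_class ` M))"
    if "x \<in> carrier (PSL_sub (psl_class ` M))" "y \<in> carrier (PSL_sub (psl_class ` M))" for x y
    using that mult by (auto simp: PSL_def psl_class_mult)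
  show "\<one>\<^bsub>PSL_sub (psl_class ` M)\<^esub> \<in> carrier (PSL_sub (psl_class ` M))"
    using one by (auto simp: PSL_def SL_center_eq_psl_class)
  show "(x \<otimes>\<^bsub>PSL_sub (psl_class ` M)\<^esub> y) \<otimes>\<^bsub>PSL_sub (psl_class ` M)\<^esub> z =
      x \<otimes>\<^bsub>PSL_sub (psl_class ` M)\<^esub> (y \<otimes>\<^bsub>PSL_sub (psl_class ` M)\<^esub> z)"
    if "x \<in> carrier (PSL_sub (psl_class ` M))" "y \<in> carrier (PSL_sub (psl_class ` M))"
      "z \<in> carrier (PSL_sub (psl_class ` M))" for x y z
    using that by (auto simp: PSL_def psl_class_mult matrix_mul_assoc)
  show "\<one>\<^bsub>PSL_sub (psl_class ` M)\<^esub> \<otimes>\<^bsub>PSL_sub (psl_class ` M)\<^esub> x = x"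
    if "x \<in> carrier (PSL_sub (psl_class ` M))" for x
    using that by (auto simp: PSL_def psl_class_mult SL_center_eq_psl_class)
  show "\<exists>y\<in>carrier (PSL_sub (psl_class ` M)).
      y \<otimes>\<^bsub>PSL_sub (psl_class ` M)\<^esub> x = \<one>\<^bsub>PSL_sub (psl_class ` M)\<^esub>"
    if x: "x \<in> carrier (PSL_sub (psl_class ` M))" for x
  proof -
    from x obtain A where "A \<in> M" "x = psl_class A" by auto
    moreover from \<open>A \<in> M\<close> inverse obtain B where "B \<in> M" "B ** A = mat 1" by blast
    ultimately show ?thesis
      by (auto simp: PSL_def psl_class_mult SL_center_eq_psl_class intro!: bexI[of _ B])
  qed
qed

lemma psl_act_psl_class_mult:
  "psl_act (psl_class (A ** B)) p = psl_act (psl_class A) (psl_act (psl_class B) p)"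
  for A B :: "'i::finite cmat"
  unfolding psl_class_mult[symmetric] psl_act_def set_mult_def SL_def
  by (auto simp: matrix_vector_mul_assoc) (metis matrix_vector_mul_assoc)+

lemma psl_act_proj: "psl_act (psl_class A) (proj w) = proj (A *v w)"
  for A :: "'i::finite cmat"
proof
  show "psl_act (psl_class A) (proj w) \<subseteq> proj (A *v w)"
  proof
    fix x assume "x \<in> psl_act (psl_class A) (proj w)"
    then obtain b c where bc: "norm b = 1" "c \<noteq> 0" "x = (mat b ** A) *v (c *s w)"
      by (auto simp: psl_act_def psl_class_altdef proj_def)
    then have "x = (b * c) *s (A *v w)"
      by (simp add: matrix_vector_mul_assoc[symmetric] mat_vector_mult vector_scalar_commute
          vector_smult_assoc)
    moreover have "b * c \<noteq> 0" using bc by auto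
    ultimately show "x \<in> proj (A *v w)" by (auto simp: proj_def)
  qed
  show "proj (A *v w) \<subseteq> psl_act (psl_class A) (proj w)"
    using mem_psl_class[of A] by (auto simp: proj_def psl_act_def vector_scalar_commute[symmetric])
qed

lemma psl_act_inverse:
  fixes A B :: "'i::finite cmat"
  assumes "A ** B = mat 1" and "p \<in> range proj"
  shows "psl_act (psl_class A) (psl_act (psl_class B) p) = p"
  using assms by (auto simp: psl_act_proj matrix_vector_mul_assoc)

lemma matrix_vector_mult_neq_0:
  fixes A B :: "'i::finite cmat"
  assumes "B ** A = mat 1" and "w \<noteq> 0"
  shows "A *v w \<noteq> 0"
proof
  assume "A *v w = 0"
  then have "B *v (A *v w) = 0" by simp
  with assms show False by (simp add: matrix_vector_mul_assoc)
qed

lemma group_action_restrictI: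
  fixes G :: "('a, 'b) monoid_scheme"
  assumes "group G"
    and closed: "\<And>g x. g \<in> carrier G \<Longrightarrow> x \<in> E \<Longrightarrow> \<phi> g x \<in> E"
    and mult: "\<And>g h x. g \<in> carrier G \<Longrightarrow> h \<in> carrier G \<Longrightarrow> x \<in> E \<Longrightarrow> \<phi> (g \<otimes>\<^bsub>G\<^esub> h) x = \<phi> g (\<phi> h x)"
    and one: "\<And>x. x \<in> E \<Longrightarrow> \<phi> \<one>\<^bsub>G\<^esub> x = x"
  shows "group_action G E (\<lambda>g. restrict (\<phi> g) E)"
proof -
  interpret group G by (rule \<open>group G\<close>)
  have bij: "restrict (\<phi> g) E \<in> Bij E" if g: "g \<in> carrier G" for g
  proof -
    have "\<phi> (inv\<^bsub>G\<^esub> g) (\<phi> g x) = x" "\<phi> g (\<phi> (inv\<^bsub>G\<^esub> g) x) = x" if "x \<in> E" for x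
      using that g mult[of "inv\<^bsub>G\<^esub> g" g x] mult[of g "inv\<^bsub>G\<^esub> g" x] one by auto
    then have "bij_betw (\<phi> g) E E"
      using g closed by (intro bij_betw_byWitness[where f' = "\<phi> (inv\<^bsub>G\<^esub> g)"]) auto
    then show ?thesis
      unfolding Bij_def by (auto cong: bij_betw_cong)
  qed
  show ?thesis
    unfolding group_action_def group_hom_def group_hom_axioms_def hom_def
    using bij closed mult is_group group_BijGroup
    by (auto simp: BijGroup_def compose_def fun_eq_iff)
qed


section \<open>Quotient topologies and holomorphic maps\<close>

lemma istopology_quotient:
  "istopology (\<lambda>U. U \<subseteq> f ` topspace X \<and> openin X {x \<in> topspace X. f x \<in> U})"
proof -
  have "{x \<in> topspace X. f x \<in> S \<inter> T} = {x \<in> topspace X. f x \<in> S} \<inter> {x \<in> topspace X. f x \<in> T}"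
    for S T by auto
  moreover have "{x \<in> topspace X. f x \<in> \<Union>\<K>} = (\<Union>K\<in>\<K>. {x \<in> topspace X. f x \<in> K})" for \<K>
    by auto
  ultimately show ?thesis
    unfolding istopology_def by (auto intro!: openin_Union)
qed

text \<open>This one construction yields the topology of projective space, that of the base of the bundle,
  and the topology transported to the image of a leaf.\<close>

lemma quotient_map_quotient_topology:
  defines "Y \<equiv> \<lambda>X f. topology (\<lambda>U. U \<subseteq> f ` topspace X \<and> openin X {x \<in> topspace X. f x \<in> U})"
  shows "quotient_map X (Y X f) f"
proof -
  have open_iff: "openin (Y X f) U \<longleftrightarrow> U \<subseteq> f ` topspace X \<and> openin X {x \<in> topspace X. f x \<in> U}" for U
    unfolding Y_def by (simp add: topology_inverse'[OF istopology_quotient])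
  moreover have "{x \<in> topspace X. f x \<in> f ` topspace X} = topspace X" by auto
  ultimately have "topspace (Y X f) = f ` topspace X"
    unfolding topspace_def[of "Y X f"] by (auto intro!: exI[of _ "f ` topspace X"])
  then show ?thesis
    by (auto simp: quotient_map_def open_iff)
qed

lemma openin_punctured_space:
  "openin (top_of_set (- {0})) {w \<in> - {0}. proj w \<in> U} \<longleftrightarrow>
    open {w :: 'i::finite cvec. w \<noteq> 0 \<and> proj w \<in> U}"
  by (simp add: openin_open_eq[OF open_Compl] Collect_mono)

lemma quotient_map_proj: "quotient_map (top_of_set (- {0})) (ctop proj_space) (proj :: 'i::finite cvec \<Rightarrow> _)"
  using quotient_map_quotient_topology[of "top_of_set (- {0})" "proj :: 'i cvec \<Rightarrow> _"]
  by (simp add: proj_space_def openin_punctured_space[simplified])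

lemma openin_proj_space:
  "openin (ctop proj_space) U \<longleftrightarrow>
    U \<subseteq> proj ` (- {0 :: 'i::finite cvec}) \<and> open {w :: 'i cvec. w \<noteq> 0 \<and> proj w \<in> U}"
  using quotient_map_proj[where 'i = 'i] openin_punctured_space[of U]
    openin_subset[of "ctop proj_space" U]
  by (auto simp: quotient_map_def)

lemma topspace_proj_space: "topspace (ctop proj_space) = proj ` (- {0 :: 'i::finite cvec})"
  using quotient_map_proj[where 'i = 'i] by (simp add: quotient_map_def)

lemma chol_proj_space:
  "chol proj_space U = {g. holomorphic_multi {w. w \<noteq> 0 \<and> proj w \<in> U} (\<lambda>w. g (proj w))}"
  by (simp add: proj_space_def)

lemma holomorphic_mapping_sub_space:
  assumes f: "holomorphic_mapping X X f" and S: "S \<subseteq> topspace (ctop X)" and fS: "f ` S \<subseteq> S"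
  shows "holomorphic_mapping (sub_space X S) (sub_space X S) f"
  unfolding holomorphic_mapping_def
proof (intro conjI allI impI)
  have f_cont: "continuous_map (ctop X) (ctop X) f"
    and f_hol: "\<And>U g. openin (ctop X) U \<Longrightarrow> g \<in> chol X U \<Longrightarrow>
      g \<circ> f \<in> chol X {p \<in> topspace (ctop X). f p \<in> U}"
    using f by (auto simp: holomorphic_mapping_def)
  show "continuous_map (ctop (sub_space X S)) (ctop (sub_space X S)) f"
    using f_cont fS S by (auto simp: sub_space_def continuous_map_in_subtopology
        continuous_map_from_subtopology)
  fix U g assume Ug: "openin (ctop (sub_space X S)) U \<and> g \<in> chol (sub_space X S) U"
  show "g \<circ> f \<in> chol (sub_space X S) {p \<in> topspace (ctop (sub_space X S)). f p \<in> U}"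
    unfolding sub_space_def complex_space.simps mem_Collect_eq
  proof (intro ballI)
    fix p assume p: "p \<in> {p \<in> topspace (subtopology (ctop X) S). f p \<in> U}"
    then obtain W g' where W: "openin (ctop X) W" "f p \<in> W" "g' \<in> chol X W" "\<forall>q\<in>W \<inter> U. g q = g' q"
      using Ug by (auto simp: sub_space_def)
    let ?W = "{p \<in> topspace (ctop X). f p \<in> W}"
    have "openin (ctop X) ?W" by (rule openin_continuous_map_preimage[OF f_cont W(1)])
    moreover have "p \<in> ?W" using p W(2) by simp
    moreover have "g' \<circ> f \<in> chol X ?W" by (rule f_hol[OF W(1,3)])
    moreover have "\<forall>q\<in>?W \<inter> {p \<in> topspace (subtopology (ctop X) S). f p \<in> U}. (g \<circ> f) q = (g' \<circ> f) q"
      using W(4) by simp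
    ultimately show "\<exists>W g'. openin (ctop X) W \<and> p \<in> W \<and> g' \<in> chol X W \<and>
        (\<forall>q\<in>W \<inter> {p \<in> topspace (subtopology (ctop X) S). f p \<in> U}. (g \<circ> f) q = g' q)"
      by blast
  qed
qed

lemma quotient_map_quotient_space:
  "quotient_map (ctop X) (ctop (quotient_space X \<pi>)) \<pi>"
  unfolding quotient_space_def by (simp add: quotient_map_quotient_topology)

text \<open>Since \<open>\<pi>\<close> is only meaningful on the points of \<open>X\<close>, the functions \<open>g \<circ> f' \<circ> \<pi>\<close> and \<open>g \<circ> \<pi> \<circ> f\<close> agree
  there only; hence the locality hypothesis on the structure sheaf.\<close>

lemma holomorphic_mapping_quotient_space:
  assumes f: "holomorphic_mapping X X f"
    and f': "\<And>p. p \<in> topspace (ctop X) \<Longrightarrow> \<pi> (f p) = f' (\<pi> p)"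
    and local: "\<And>U g g'. g \<in> chol X U \<Longrightarrow> (\<And>p. p \<in> U \<Longrightarrow> g p = g' p) \<Longrightarrow> g' \<in> chol X U"
  shows "holomorphic_mapping (quotient_space X \<pi>) (quotient_space X \<pi>) f'"
  unfolding holomorphic_mapping_def
proof (intro conjI allI impI)
  let ?Q = "quotient_space X \<pi>"
  have f_cont: "continuous_map (ctop X) (ctop X) f"
    and f_hol: "\<And>U g. openin (ctop X) U \<Longrightarrow> g \<in> chol X U \<Longrightarrow>
      g \<circ> f \<in> chol X {p \<in> topspace (ctop X). f p \<in> U}"
    using f by (auto simp: holomorphic_mapping_def)
  note \<pi>_quot = quotient_map_quotient_space[of X \<pi>]
  then have \<pi>_cont: "continuous_map (ctop X) (ctop ?Q) \<pi>"
    by (rule quotient_imp_continuous_map)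
  have "continuous_map (ctop X) (ctop ?Q) (f' \<circ> \<pi>)"
    using continuous_map_compose[OF f_cont \<pi>_cont] f' by (auto elim: continuous_map_eq)
  then show "continuous_map (ctop ?Q) (ctop ?Q) f'"
    using continuous_compose_quotient_map_eq[OF \<pi>_quot] by blast
  fix U g assume Ug: "openin (ctop ?Q) U \<and> g \<in> chol ?Q U"
  let ?V = "{p \<in> topspace (ctop X). \<pi> p \<in> U}"
  have "openin (ctop X) ?V" using Ug openin_continuous_map_preimage[OF \<pi>_cont] by blast
  moreover have "g \<circ> \<pi> \<in> chol X ?V" using Ug by (auto simp: quotient_space_def)
  ultimately have "(g \<circ> \<pi>) \<circ> f \<in> chol X {p \<in> topspace (ctop X). f p \<in> ?V}" by (rule f_hol)
  moreover have "{p \<in> topspace (ctop X). f p \<in> ?V} =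
      {p \<in> topspace (ctop X). \<pi> p \<in> {b \<in> topspace (ctop ?Q). f' b \<in> U}}"
    using f' continuous_map_image_subset_topspace[OF f_cont]
      continuous_map_image_subset_topspace[OF \<pi>_cont] by auto
  ultimately have "(g \<circ> f') \<circ> \<pi> \<in>
      chol X {p \<in> topspace (ctop X). \<pi> p \<in> {b \<in> topspace (ctop ?Q). f' b \<in> U}}"
    using f' by (auto intro: local)
  then show "g \<circ> f' \<in> chol ?Q {b \<in> topspace (ctop ?Q). f' b \<in> U}"
    by (simp add: quotient_space_def)
qed

lemma sub_space_chol_local:
  "g \<in> chol (sub_space X S) U \<Longrightarrow> (\<And>p. p \<in> U \<Longrightarrow> g p = g' p) \<Longrightarrow> g' \<in> chol (sub_space X S) U"
  by (simp add: sub_space_def)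

lemma bounded_linear_matrix_vector_mult: "bounded_linear ((*v) (A :: 'i::finite cmat))"
  using matrix_vector_mul_linear[of A] by (simp add: linear_conv_bounded_linear)

lemma holomorphic_mapping_psl_act:
  fixes A B :: "'i::finite cmat"
  assumes AB: "B ** A = mat 1"
  shows "holomorphic_mapping proj_space proj_space (psl_act (psl_class A))"
proof -
  let ?f = "psl_act (psl_class A)"
  have nz: "A *v w \<noteq> 0" if "w \<noteq> 0" for w
    using matrix_vector_mult_neq_0[OF AB that] .
  let ?lift = "\<lambda>U. {w :: 'i cvec. w \<noteq> 0 \<and> proj w \<in> U}"
  have lift: "?lift {p \<in> topspace (ctop proj_space). ?f p \<in> U} = (\<lambda>w. A *v w) -` ?lift U" for U
  proof (intro equalityI subsetI)
    fix w :: "'i cvec"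
    assume "w \<in> ?lift {p \<in> topspace (ctop proj_space). ?f p \<in> U}"
    then show "w \<in> (\<lambda>w. A *v w) -` ?lift U"
      using nz[of w] by (simp add: psl_act_proj)
  next
    fix w :: "'i cvec"
    assume "w \<in> (\<lambda>w. A *v w) -` ?lift U"
    then have "A *v w \<noteq> 0" "proj (A *v w) \<in> U" by auto
    moreover from this have "w \<noteq> 0" by auto
    ultimately show "w \<in> ?lift {p \<in> topspace (ctop proj_space). ?f p \<in> U}"
      by (simp add: topspace_proj_space psl_act_proj)
  qed
  have cont: "continuous_on UNIV (\<lambda>w. A *v w)"
    by (rule linear_continuous_on[OF bounded_linear_matrix_vector_mult])
  have open_lift: "open ((\<lambda>w. A *v w) -` ?lift U)" if "open (?lift U)" for U
    using open_vimage[OF that cont] .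
  have maps: "?f p \<in> topspace (ctop proj_space)" if "p \<in> topspace (ctop proj_space)" for p
    using that nz unfolding topspace_proj_space by (force simp: psl_act_proj)
  have "continuous_map (ctop proj_space) (ctop proj_space) ?f"
    unfolding continuous_map_def
  proof (intro conjI allI impI)
    show "?f \<in> topspace (ctop proj_space) \<rightarrow> topspace (ctop proj_space)"
      using maps by blast
    fix U :: "'i cvec set set" assume "openin (ctop proj_space) U"
    then have "open (?lift {p \<in> topspace (ctop proj_space). ?f p \<in> U})"
      unfolding lift using open_lift unfolding openin_proj_space by blast
    then show "openin (ctop proj_space) {p \<in> topspace (ctop proj_space). ?f p \<in> U}"
      unfolding openin_proj_space[of "{p \<in> topspace (ctop proj_space). ?f p \<in> U}"]
      unfolding topspace_proj_space by blast
  qed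
  moreover have "g \<circ> ?f \<in> chol proj_space {p \<in> topspace (ctop proj_space). ?f p \<in> U}"
    if g: "g \<in> chol proj_space U" for U g
  proof -
    have "\<exists>L. ((\<lambda>w. (g \<circ> ?f) (proj w)) has_derivative L) (at w) \<and> (\<forall>c v. L (c *s v) = c * L v)"
      if w: "A *v w \<in> ?lift U" for w
    proof -
      obtain L where L: "((\<lambda>w. g (proj w)) has_derivative L) (at (A *v w))"
        and L_lin: "\<And>c v. L (c *s v) = c * L v"
        using g w unfolding chol_proj_space holomorphic_multi_def by blast
      have "((\<lambda>w. A *v w) has_derivative (\<lambda>w. A *v w)) (at w)"
        by (rule bounded_linear_imp_has_derivative[OF bounded_linear_matrix_vector_mult])
      from has_derivative_compose[OF this L]
      have "((\<lambda>w. (g \<circ> ?f) (proj w)) has_derivative (\<lambda>v. L (A *v v))) (at w)"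
        by (simp add: psl_act_proj)
      moreover have "L (A *v (c *s v)) = c * L (A *v v)" for c v
        by (simp only: vector_scalar_commute L_lin)
      ultimately show ?thesis by blast
    qed
    moreover have "open (?lift U)" using g by (simp add: chol_proj_space holomorphic_multi_def)
    ultimately show ?thesis
      unfolding chol_proj_space holomorphic_multi_def mem_Collect_eq lift[unfolded mem_Collect_eq]
      using open_lift[of U] by (auto simp: vimage_def)
  qed
  ultimately show ?thesis unfolding holomorphic_mapping_def by blast
qed

section \<open>Diagonal matrices acting on the bundle\<close>

lemma diag_matrix_vector_mult: "diag_matrix d *v w = (\<chi> i. d i * w $ i)" for w :: "'i::finite cvec"
  by (simp add: diag_matrix_def matrix_vector_mult_def vec_eq_iff if_distrib[of "\<lambda>x. x * _"]
      cong: if_cong)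

lemma diag_matrix_mult: "diag_matrix d ** diag_matrix e = diag_matrix (\<lambda>i::'i::finite. d i * e i)"
  by (simp add: diag_matrix_def matrix_matrix_mult_def vec_eq_iff if_distrib[of "\<lambda>x. x * _"]
      cong: if_cong)

lemma diag_matrix_one: "diag_matrix (\<lambda>i::'i::finite. 1) = mat 1"
  by (simp add: diag_matrix_def mat_def)

lemma diag_matrix_inverse:
  assumes "\<And>i::'i::finite. d i \<noteq> 0"
  shows "diag_matrix (\<lambda>i. inverse (d i)) ** diag_matrix d = mat 1"
    and "diag_matrix d ** diag_matrix (\<lambda>i. inverse (d i)) = mat 1"
  using assms by (simp_all add: diag_matrix_mult diag_matrix_one)

text \<open>Every coordinate lies in one of the blocks \<open>0, \<dots>, l\<close>, so the conditions that define the groups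
  constrain all diagonal entries.\<close>

lemma block_le_length:
  assumes "CARD('i::{finite,linorder}) = n + 1" and "sum_list k = n"
  shows "block k (i :: 'i) \<le> length k"
proof -
  have "card {a. a < i} \<le> card (UNIV - {i})" by (rule card_mono) auto
  with assms show ?thesis
    unfolding block_def index_rank_def by (intro Least_le) simp
qed

text \<open>The groups \<open>G\<^sub>j\<close>, \<open>\<T>\<^sub>j\<close>, \<open>H\<^sub>j\<close> and \<open>\<T>\<close> all consist of such classes. The proof rests on two properties
  that these classes share: they commute with each other, and rescaling the coordinates by nonzero factors
  preserves the vanishing of blocks and hence each \<open>V\<^sub>j\<close>.\<close>

definition diag_classes :: "'i::finite cmat set set" where
  "diag_classes = {psl_class (diag_matrix d) | d. \<forall>i. d i \<noteq> 0}"

lemma G_grp_subset_diag_classes: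
  assumes "\<And>i :: 'i::{finite,linorder}. block k i \<le> length k"
  shows "G_grp k j \<subseteq> (diag_classes :: 'i cmat set set)"
proof
  fix g :: "'i cmat set" assume "g \<in> G_grp k j"
  then obtain z where "g = psl_class (block_scalar k z)" "\<forall>r\<le>length k. z r \<noteq> 0"
    by (auto simp: G_grp_def)
  with assms show "g \<in> diag_classes"
    unfolding diag_classes_def block_scalar_def by blast
qed

lemma T_grp_unitary:
  assumes "h \<in> (T_grp :: 'i::finite cmat set set)"
  obtains d where "h = psl_class (diag_matrix d)" "\<And>i. d i * cnj (d i) = 1"
proof -
  obtain d where h: "h = psl_class (diag_matrix d)"
    and unitary: "diag_matrix d ** transpose (map_matrix cnj (diag_matrix d)) = (mat 1 :: 'i cmat)"
    using assms by (auto simp: T_grp_def)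
  have "transpose (map_matrix cnj (diag_matrix d)) = (diag_matrix (\<lambda>i. cnj (d i)) :: 'i cmat)"
    by (auto simp: transpose_def map_matrix_def diag_matrix_def vec_eq_iff)
  with unitary have eq: "diag_matrix (\<lambda>i. d i * cnj (d i)) = (mat 1 :: 'i cmat)"
    by (simp add: diag_matrix_mult)
  have "d i * cnj (d i) = 1" for i
    using arg_cong[OF eq, of "\<lambda>M. M $ i $ i"] by (simp add: diag_matrix_def mat_def)
  with h that show thesis by blast
qed

definition H_entries :: "nat list \<Rightarrow> nat \<Rightarrow> ('i::{finite,linorder} \<Rightarrow> complex) set" where
  "H_entries k j = {d. (\<forall>i. block k i = 0 \<or> block k i < j \<longrightarrow> d i = 1) \<and>
      (\<forall>r. 1 \<le> r \<and> j \<le> r \<and> r \<le> length k \<longrightarrow> (\<Prod>i | block k i = r. d i) = 1)}"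

lemma H_grp_altdef: "H_grp k j = psl_class ` diag_matrix ` H_entries k j"
  by (auto simp: H_grp_def H_entries_def)

lemma H_entries_nonzero:
  fixes i :: "'i::{finite,linorder}"
  assumes "block k i \<le> length k" and "d \<in> H_entries k j"
  shows "d i \<noteq> 0"
proof (cases "block k i = 0 \<or> block k i < j")
  case True
  then show ?thesis using assms by (auto simp: H_entries_def)
next
  case False
  then have "(\<Prod>a | block k a = block k i. d a) = 1"
    using assms by (auto simp: H_entries_def)
  then have "(\<Prod>a | block k a = block k i. d a) \<noteq> 0" by simp
  then show ?thesis by (auto simp del: prod_zero_iff simp add: prod_zero_iff[OF finite])
qed

lemma H_grp_subset_diag_classes:
  assumes "\<And>i :: 'i::{finite,linorder}. block k i \<le> length k"
  shows "H_grp k j \<subseteq> (diag_classes :: 'i cmat set set)"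
  using H_entries_nonzero[OF assms] by (fastforce simp: H_grp_altdef diag_classes_def)

text \<open>The conditions on the entries are multiplicative because block determinants are.\<close>

lemma group_H_grp:
  assumes "\<And>i :: 'i::{finite,linorder}. block k i \<le> length k"
  shows "group (PSL_sub (H_grp k j :: 'i cmat set set))"
  unfolding H_grp_altdef
proof (rule group_PSL_sub)
  have "(\<lambda>_. 1) \<in> (H_entries k j :: ('i \<Rightarrow> complex) set)" by (auto simp: H_entries_def)
  then show "mat 1 \<in> diag_matrix ` (H_entries k j :: ('i \<Rightarrow> complex) set)"
    using diag_matrix_one by (metis imageI)
next
  fix A B :: "'i cmat" assume "A \<in> diag_matrix ` H_entries k j" "B \<in> diag_matrix ` H_entries k j"
  then obtain d e where de: "A = diag_matrix d" "d \<in> H_entries k j" "B = diag_matrix e" "e \<in> H_entries k j"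
    by blast
  then have "(\<lambda>i. d i * e i) \<in> H_entries k j" by (auto simp: H_entries_def prod.distrib)
  with de show "A ** B \<in> diag_matrix ` H_entries k j" by (simp add: diag_matrix_mult)
next
  fix A :: "'i cmat" assume "A \<in> diag_matrix ` H_entries k j"
  then obtain d where d: "A = diag_matrix d" "d \<in> H_entries k j" by blast
  have "(\<lambda>i. inverse (d i)) \<in> H_entries k j"
    using d(2) by (auto simp: H_entries_def prod_inversef[unfolded comp_def])
  moreover have "diag_matrix (\<lambda>i. inverse (d i)) ** A = mat 1"
    using d H_entries_nonzero[OF assms] by (simp add: diag_matrix_inverse)
  ultimately show "\<exists>B\<in>diag_matrix ` H_entries k j. B ** A = mat 1" by blast
qed

lemma psl_act_diag_commute:
  assumes "g \<in> diag_classes" and "h \<in> (diag_classes :: 'i::finite cmat set set)"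
  shows "psl_act h (psl_act g p) = psl_act g (psl_act h p)"
proof -
  obtain d e where "g = psl_class (diag_matrix d)" "h = psl_class (diag_matrix e)"
    using assms by (auto simp: diag_classes_def)
  then show ?thesis
    by (simp add: psl_act_psl_class_mult[symmetric] diag_matrix_mult mult.commute)
qed

text \<open>A map that commutes with a group permutes the orbits of this group. With \<open>G\<^sub>j\<close> for \<open>K\<close> this lets \<open>h\<close>
  descend to the base, with \<open>\<T>\<^sub>j\<close> for \<open>K\<close> it moves the leaves of the first foliation.\<close>

lemma orbit_psl_act_diag:
  assumes "K \<subseteq> diag_classes" and "h \<in> (diag_classes :: 'i::finite cmat set set)"
  shows "orbit (PSL_sub K) psl_act (psl_act h p) = psl_act h ` orbit (PSL_sub K) psl_act p"
proof -
  have "psl_act g (psl_act h p) = psl_act h (psl_act g p)" if "g \<in> K" for g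
    using that assms psl_act_diag_commute by blast
  then show ?thesis by (force simp: orbit_def)
qed

lemma V_set_subset: "V_set k j \<subseteq> proj ` (- {0 :: 'i::{finite,linorder} cvec})"
  by (auto simp: V_set_def)

lemma psl_act_V_set:
  assumes h: "h \<in> diag_classes" and p: "p \<in> (V_set k j :: 'i::{finite,linorder} cvec set set)"
  shows "psl_act h p \<in> V_set k j"
proof -
  obtain d where d: "h = psl_class (diag_matrix d)" "\<And>i. d i \<noteq> 0"
    using h by (auto simp: diag_classes_def)
  obtain w where w: "p = proj w" "w \<noteq> 0" "\<forall>r<j. block_comp k r w = 0"
      "\<forall>r\<in>{j..length k}. block_comp k r w \<noteq> 0"
    using p by (auto simp: V_set_def)
  have "block_comp k r (diag_matrix d *v w) = 0 \<longleftrightarrow> block_comp k r w = 0" for r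
    using d(2) by (simp add: block_comp_def diag_matrix_vector_mult vec_eq_iff)
  moreover have "diag_matrix d *v w \<noteq> 0"
    using d(2) w(2) by (simp add: diag_matrix_vector_mult vec_eq_iff)
  ultimately show ?thesis
    using d w by (auto simp: V_set_def psl_act_proj)
qed

lemma diag_class_inverse:
  assumes "h \<in> (diag_classes :: 'i::finite cmat set set)"
  shows "\<exists>h'\<in>diag_classes. \<forall>p\<in>proj ` (- {0}).
    psl_act h' (psl_act h p) = p \<and> psl_act h (psl_act h' p) = p"
proof -
  obtain d where d: "h = psl_class (diag_matrix d)" "\<And>i. d i \<noteq> 0"
    using assms by (auto simp: diag_classes_def)
  show ?thesis
  proof (intro bexI ballI conjI)
    show "psl_class (diag_matrix (\<lambda>i. inverse (d i))) \<in> diag_classes"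
      using d(2) by (auto simp: diag_classes_def)
  qed (use d in \<open>auto intro!: psl_act_inverse diag_matrix_inverse\<close>)
qed

lemma topspace_V_space: "topspace (ctop (V_space k j)) = V_set k j"
  using V_set_subset by (auto simp: V_space_def sub_space_def topspace_proj_space)

lemma base_set_altdef: "base_set k j = bundle_proj k j ` V_set k j"
  by (auto simp: base_set_def orbits_def bundle_proj_def)

lemma topspace_base_space: "topspace (ctop (base_space k j)) = base_set k j"
  using quotient_map_quotient_space[of "V_space k j" "bundle_proj k j"]
  unfolding quotient_map_def base_space_def topspace_V_space base_set_altdef by (elim conjE) (rule sym)

lemma holomorphic_mapping_V_space:
  assumes h: "h \<in> diag_classes"
  shows "holomorphic_mapping (V_space k j) (V_space k j) (psl_act (h :: 'i::{finite,linorder} cmat set))"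
proof -
  obtain d where d: "h = psl_class (diag_matrix d)" "\<And>i. d i \<noteq> 0"
    using h by (auto simp: diag_classes_def)
  have "holomorphic_mapping proj_space proj_space (psl_act h)"
    unfolding d(1) using holomorphic_mapping_psl_act diag_matrix_inverse(1)[of d] d(2) by blast
  then show ?thesis
    unfolding V_space_def
    using psl_act_V_set[OF h] V_set_subset
    by (intro holomorphic_mapping_sub_space) (simp_all add: topspace_proj_space image_subset_iff)
qed

context
  fixes k :: "nat list" and j :: nat
  assumes G_diag: "G_grp k j \<subseteq> (diag_classes :: 'i::{finite,linorder} cmat set set)"
begin

lemma bundle_proj_psl_act:
  "h \<in> diag_classes \<Longrightarrow> bundle_proj k j (psl_act h p) = psl_act h ` bundle_proj k j (p :: 'i cvec set)"
  unfolding bundle_proj_def by (rule orbit_psl_act_diag[OF G_diag])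

lemma image_base_set:
  assumes h: "h \<in> diag_classes" and b: "b \<in> (base_set k j :: 'i cvec set set set)"
  shows "psl_act h ` b \<in> base_set k j"
proof -
  obtain p where p: "p \<in> V_set k j" and b_eq: "b = bundle_proj k j p"
    using b unfolding base_set_altdef by blast
  have "psl_act h ` b = bundle_proj k j (psl_act h p)"
    unfolding b_eq bundle_proj_psl_act[OF h] ..
  then show ?thesis
    unfolding base_set_altdef using psl_act_V_set[OF h p] by simp
qed

lemma base_set_subset:
  assumes "b \<in> (base_set k j :: 'i cvec set set set)"
  shows "b \<subseteq> V_set k j"
proof -
  obtain p where p: "p \<in> V_set k j" and b_eq: "b = bundle_proj k j p"
    using assms unfolding base_set_altdef by blast
  have "psl_act g p \<in> V_set k j" if "g \<in> G_grp k j" for g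
    using that G_diag p by (intro psl_act_V_set) auto
  then show ?thesis by (auto simp: b_eq bundle_proj_def orbit_def)
qed

text \<open>The induced map of the base sends an orbit to its image under \<open>h\<close>; it is invertible since the inverse
  of \<open>h\<close> induces the inverse map.\<close>

lemma principal_bundle_automorphism_diag:
  assumes h: "h \<in> (diag_classes :: 'i cmat set set)"
  shows "principal_bundle_automorphism (V_space k j) (base_space k j) (bundle_proj k j)
    (G_grp k j) psl_act (psl_act h) (restrict ((`) (psl_act h)) (base_set k j))"
proof -
  have base: "holomorphic_mapping (base_space k j) (base_space k j)
      (restrict ((`) (psl_act g)) (base_set k j))"
    if g: "g \<in> (diag_classes :: 'i cmat set set)" for g
    unfolding base_space_def
  proof (rule holomorphic_mapping_quotient_space[OF holomorphic_mapping_V_space[OF g]])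
    show "bundle_proj k j (psl_act g p) = restrict ((`) (psl_act g)) (base_set k j) (bundle_proj k j p)"
      if "p \<in> topspace (ctop (V_space k j))" for p
      using that g bundle_proj_psl_act by (simp add: topspace_V_space base_set_altdef)
  qed (unfold V_space_def, erule sub_space_chol_local)
  obtain h' where h': "h' \<in> diag_classes"
    and inv: "\<forall>p\<in>proj ` (- {0}).
      psl_act h' (psl_act h p) = p \<and> psl_act h (psl_act h' p) = p"
    using diag_class_inverse[OF h] by (elim bexE)
  have V_inv: "psl_act h' (psl_act h p) = p" "psl_act h (psl_act h' p) = p"
    if "p \<in> V_set k j" for p :: "'i cvec set"
    using inv[rule_format, of p] that V_set_subset by auto
  have base_inv: "psl_act h' ` psl_act h ` b = b" "psl_act h ` psl_act h' ` b = b"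
    if "b \<in> base_set k j" for b :: "'i cvec set set"
  proof -
    have "psl_act h' (psl_act h p) = p" "psl_act h (psl_act h' p) = p" if "p \<in> b" for p
      using base_set_subset[OF \<open>b \<in> base_set k j\<close>] that V_inv[of p] by auto
    then show "psl_act h' ` psl_act h ` b = b" "psl_act h ` psl_act h' ` b = b"
      by (simp_all add: image_image)
  qed
  have total: "biholomorphic_mapping (V_space k j) (V_space k j) (psl_act h)"
    unfolding biholomorphic_mapping_def topspace_V_space
    using holomorphic_mapping_V_space[OF h] holomorphic_mapping_V_space[OF h'] V_inv
    by (intro conjI exI[of _ "psl_act h'"]) simp_all
  have base_iso: "biholomorphic_mapping (base_space k j) (base_space k j)
      (restrict ((`) (psl_act h)) (base_set k j))"
    unfolding biholomorphic_mapping_def topspace_base_space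
  proof (intro conjI exI)
    show "\<forall>b\<in>base_set k j. restrict ((`) (psl_act h')) (base_set k j)
        (restrict ((`) (psl_act h)) (base_set k j) b) = b"
      using base_inv image_base_set[OF h] by simp
    show "\<forall>b\<in>base_set k j. restrict ((`) (psl_act h)) (base_set k j)
        (restrict ((`) (psl_act h')) (base_set k j) b) = b"
      using base_inv image_base_set[OF h'] by simp
  qed (rule base[OF h] base[OF h'])+
  have cover: "bundle_proj k j (psl_act h p) =
      restrict ((`) (psl_act h)) (base_set k j) (bundle_proj k j p)" if "p \<in> V_set k j" for p
    using that bundle_proj_psl_act[OF h] by (simp add: base_set_altdef)
  have equivariant: "psl_act h (psl_act g p) = psl_act g (psl_act h p)" if "g \<in> G_grp k j" for g p
    using that G_diag psl_act_diag_commute[OF _ h] by (simp add: subset_iff)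
  show ?thesis
    unfolding principal_bundle_automorphism_def topspace_V_space
    by (intro conjI ballI total base_iso cover equivariant)
qed

lemma image_fibers:
  assumes h: "h \<in> diag_classes" and F: "F \<in> (fibers k j :: 'i cvec set set set)"
  shows "psl_act h ` F \<in> fibers k j"
proof -
  obtain b where b: "b \<in> base_set k j" and F_eq: "F = {p \<in> V_set k j. bundle_proj k j p = b}"
    using F by (auto simp: fibers_def)
  obtain h' where h': "h' \<in> diag_classes"
    and inv: "\<forall>p\<in>proj ` (- {0}).
      psl_act h' (psl_act h p) = p \<and> psl_act h (psl_act h' p) = p"
    using diag_class_inverse[OF h] by (elim bexE)
  have V_inv: "psl_act h' (psl_act h p) = p" "psl_act h (psl_act h' p) = p"
    if "p \<in> V_set k j" for p :: "'i cvec set"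
    using inv[rule_format, of p] that V_set_subset by auto
  then have "psl_act h' (psl_act h p) = p" if "p \<in> b" for p
    using that base_set_subset[OF b] by (simp add: subset_iff)
  then have b_inv: "psl_act h' ` psl_act h ` b = b"
    by (simp add: image_image)
  have "psl_act h ` F = {q \<in> V_set k j. bundle_proj k j q = psl_act h ` b}"
  proof (intro equalityI subsetI)
    fix q assume "q \<in> psl_act h ` F"
    then show "q \<in> {q \<in> V_set k j. bundle_proj k j q = psl_act h ` b}"
      using psl_act_V_set[OF h] bundle_proj_psl_act[OF h] by (auto simp: F_eq)
  next
    fix q assume q: "q \<in> {q \<in> V_set k j. bundle_proj k j q = psl_act h ` b}"
    then have "psl_act h' q \<in> F"
      using psl_act_V_set[OF h'] bundle_proj_psl_act[OF h'] b_inv by (auto simp: F_eq)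
    moreover have "q = psl_act h (psl_act h' q)" using q V_inv(2) by simp
    ultimately show "q \<in> psl_act h ` F" by blast
  qed
  then show ?thesis using image_base_set[OF h b] by (auto simp: fibers_def)
qed

end

lemma orbit_foliation_image:
  assumes "T_j_grp k j \<subseteq> (diag_classes :: 'i cmat set set)" and "h \<in> (diag_classes :: 'i::{finite,linorder} cmat set set)"
  shows "(\<lambda>L. psl_act h ` L) ` orbit_foliation k j F = orbit_foliation k j (psl_act h ` F)"
  unfolding orbit_foliation_def orbits_def
  using orbit_psl_act_diag[OF assms] by (auto simp: image_iff)

section \<open>Unitary maps preserve the normal distribution\<close>

text \<open>The differential of the projective map \<open>[w] \<mapsto> [A w]\<close>, acting on encoded tangent vectors.\<close>

definition proj_deriv ::
    "'i::finite cmat \<Rightarrow> ('i cvec \<times> 'i cvec) set \<Rightarrow> ('i cvec \<times> 'i cvec) set" where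
  "proj_deriv A X = (\<lambda>(w, u). (A *v w, A *v u)) ` X"

lemma proj_deriv_tvec: "proj_deriv A (tvec w u) = tvec (A *v w) (A *v u)" for A :: "'a::finite cmat"
proof -
  have tvec_eq: "tvec w u = (\<lambda>(c, b). (c *s w, c *s u + b *s w)) ` ({c. c \<noteq> 0} \<times> UNIV)"
    for w u :: "'a cvec"
    by (auto simp: tvec_def)
  show ?thesis
    unfolding tvec_eq proj_deriv_def image_image
    by (simp add: case_prod_unfold matrix_vector_right_distrib vector_scalar_commute)
qed

lemma proj_deriv_inverse: "B ** A = mat 1 \<Longrightarrow> proj_deriv B (proj_deriv A X) = X"
  by (simp add: proj_deriv_def image_image matrix_vector_mul_assoc case_prod_unfold)

text \<open>Outside \<open>S\<close> the map \<open>f\<close> need not be differentiable, so the chain rule for \<open>T \<circ> f\<close> is an equation on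
  \<open>S\<close> only; iterating it requires that \<open>C\<^sup>m\<close> depends on the values in the open set alone.\<close>

lemma Cm_on_cong_open:
  assumes "open S" and "\<And>x. x \<in> S \<Longrightarrow> f x = g x" and "Cm_on m S f"
  shows "Cm_on m S g"
  using assms(2,3)
proof (induction m arbitrary: f g)
  case 0
  then show ?case by (auto cong: continuous_on_cong)
next
  case (Suc m)
  have deriv: "(g has_derivative frechet_derivative f (at x)) (at x)" if "x \<in> S" for x
  proof (rule has_derivative_transform_within_open[OF _ assms(1) that])
    show "(f has_derivative frechet_derivative f (at x)) (at x)"
      using Suc.prems(2) that by (simp add: frechet_derivative_works[symmetric])
  qed (rule Suc.prems(1))
  then have "frechet_derivative f (at x) = frechet_derivative g (at x)" if "x \<in> S" for x
    using that frechet_derivative_at by blast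
  then have "Cm_on m S (\<lambda>x. frechet_derivative g (at x) v)" for v
    using Suc.IH[of "\<lambda>x. frechet_derivative f (at x) v"] Suc.prems by simp
  then show ?case using deriv by (auto simp: differentiable_def)
qed

lemma frechet_derivative_bounded_linear_comp:
  assumes "bounded_linear T" and "f differentiable (at x)"
  shows "((\<lambda>x. T (f x)) has_derivative (\<lambda>v. T (frechet_derivative f (at x) v))) (at x)"
    and "frechet_derivative (\<lambda>x. T (f x)) (at x) = (\<lambda>v. T (frechet_derivative f (at x) v))"
proof -
  show *: "((\<lambda>x. T (f x)) has_derivative (\<lambda>v. T (frechet_derivative f (at x) v))) (at x)"
    using assms bounded_linear.has_derivative frechet_derivative_works by blast
  show "frechet_derivative (\<lambda>x. T (f x)) (at x) = (\<lambda>v. T (frechet_derivative f (at x) v))"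
    using frechet_derivative_at[OF *] by simp
qed

lemma Cm_on_bounded_linear:
  assumes T: "bounded_linear T" and S: "open S" and "Cm_on m S f"
  shows "Cm_on m S (\<lambda>x. T (f x))"
  using assms(3)
proof (induction m arbitrary: f)
  case 0
  then show ?case using bounded_linear.continuous_on[OF T] by simp
next
  case (Suc m)
  have "Cm_on m S (\<lambda>x. frechet_derivative (\<lambda>x. T (f x)) (at x) v)" for v
  proof (rule Cm_on_cong_open[OF S])
    show "Cm_on m S (\<lambda>x. T (frechet_derivative f (at x) v))"
      using Suc by simp
    show "T (frechet_derivative f (at x) v) = frechet_derivative (\<lambda>x. T (f x)) (at x) v"
      if "x \<in> S" for x
      using Suc.prems that frechet_derivative_bounded_linear_comp(2)[OF T, of f x] by simp
  qed
  moreover have "(\<lambda>x. T (f x)) differentiable (at x)" if "x \<in> S" for x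
    using Suc.prems that frechet_derivative_bounded_linear_comp(1)[OF T, of f x]
    by (intro differentiableI) simp
  ultimately show ?case by simp
qed

lemma Cinf_on_matrix_vector_mult:
  "open S \<Longrightarrow> Cinf_on S c \<Longrightarrow> Cinf_on S (\<lambda>t. A *v c t)" for A :: "'i::finite cmat"
  unfolding Cinf_on_def
  using Cm_on_bounded_linear[OF bounded_linear_matrix_vector_mult] by blast

lemma Cinf_on_differentiable: "Cinf_on S f \<Longrightarrow> x \<in> S \<Longrightarrow> f differentiable (at x)"
  unfolding Cinf_on_def by (metis Cm_on.simps(2))

lemma tangent_space_image_subset:
  fixes A B :: "'i::finite cmat"
  assumes BA: "B ** A = mat 1"
  shows "proj_deriv A ` tangent_space S p \<subseteq>
    tangent_space (psl_act (psl_class A) ` S) (psl_act (psl_class A) p)"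
proof (rule image_subsetI)
  fix X assume "X \<in> tangent_space S p"
  then obtain c e where e: "0 < e" and c: "Cinf_on {-e<..<e::real} c"
    and S: "\<forall>t\<in>{-e<..<e}. c t \<noteq> 0 \<and> proj (c t) \<in> S" and p: "proj (c 0) = p"
    and X: "X = tvec (c 0) (vector_derivative c (at 0))"
    by (auto simp: tangent_space_def)
  have "(c has_vector_derivative vector_derivative c (at 0)) (at 0)"
    using Cinf_on_differentiable[OF c, of 0] e by (simp add: vector_derivative_works)
  from bounded_linear.has_vector_derivative[OF bounded_linear_matrix_vector_mult this]
  have "vector_derivative (\<lambda>t. A *v c t) (at 0) = A *v vector_derivative c (at 0)"
    by (rule vector_derivative_at)
  then have "proj_deriv A X = tvec (A *v c 0) (vector_derivative (\<lambda>t. A *v c t) (at 0))"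
    by (simp add: X proj_deriv_tvec)
  moreover have "Cinf_on {-e<..<e} (\<lambda>t. A *v c t)"
    using c by (intro Cinf_on_matrix_vector_mult) auto
  moreover have "\<forall>t\<in>{-e<..<e}. A *v c t \<noteq> 0 \<and> proj (A *v c t) \<in> psl_act (psl_class A) ` S"
    using S matrix_vector_mult_neq_0[OF BA] by (auto simp: psl_act_proj[symmetric])
  moreover have "proj (A *v c 0) = psl_act (psl_class A) p"
    using p psl_act_proj by blast
  ultimately show "proj_deriv A X \<in> tangent_space (psl_act (psl_class A) ` S) (psl_act (psl_class A) p)"
    using e unfolding tangent_space_def by (intro CollectI exI conjI)
qed

lemma psl_act_image_inverse:
  fixes A B :: "'i::finite cmat"
  assumes "B ** A = mat 1" and "S \<subseteq> proj ` (- {0})"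
  shows "psl_act (psl_class B) ` psl_act (psl_class A) ` S = S"
proof -
  have "psl_act (psl_class B) (psl_act (psl_class A) p) = p" if "p \<in> S" for p
    using that assms by (intro psl_act_inverse) auto
  then show ?thesis by (simp add: image_image)
qed

text \<open>The inclusion for the inverse matrix gives the converse of the inclusion for \<open>A\<close>.\<close>

lemma tangent_space_image:
  fixes A B :: "'i::finite cmat"
  assumes BA: "B ** A = mat 1" and S: "S \<subseteq> proj ` (- {0})" and p: "p \<in> proj ` (- {0})"
  shows "tangent_space (psl_act (psl_class A) ` S) (psl_act (psl_class A) p) =
    proj_deriv A ` tangent_space S p"
proof (rule equalityI)
  have AB: "A ** B = mat 1" using BA by (simp add: matrix_left_right_inverse)
  let ?T = "tangent_space (psl_act (psl_class A) ` S) (psl_act (psl_class A) p)"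
  have "psl_act (psl_class B) (psl_act (psl_class A) p) = p"
    using p by (intro psl_act_inverse[OF BA]) auto
  then have "proj_deriv B ` ?T \<subseteq> tangent_space S p"
    using tangent_space_image_subset[OF AB, of "psl_act (psl_class A) ` S" "psl_act (psl_class A) p"]
    by (simp add: psl_act_image_inverse[OF BA S])
  then have "proj_deriv A ` proj_deriv B ` ?T \<subseteq> proj_deriv A ` tangent_space S p" by blast
  then show "?T \<subseteq> proj_deriv A ` tangent_space S p"
    by (simp add: image_image proj_deriv_inverse[OF AB])
qed (rule tangent_space_image_subset[OF BA])

lemma norm_sq_eq_hinner: "(norm w)\<^sup>2 = Re (hinner w w)"
  by (simp add: norm_vec_def L2_set_def sum_nonneg hinner_def complex_norm_square[symmetric])

text \<open>The conditions on \<open>r\<close> that define the two values of \<open>fs_metric\<close> are equivalent, because \<open>A\<close> and its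
  inverse carry representatives to representatives with the same inner products. Hence the two definite
  descriptions coincide, also for vectors at different points, where no \<open>r\<close> satisfies the conditions.\<close>

lemma fs_metric_proj_deriv:
  fixes A B :: "'i::finite cmat"
  assumes BA: "B ** A = mat 1" and A: "\<And>u v. hinner (A *v u) (A *v v) = hinner u v"
  shows "fs_metric (proj_deriv A X) (proj_deriv A Y) = fs_metric X Y"
proof -
  have AB: "A ** B = mat 1" using BA by (simp add: matrix_left_right_inverse)
  let ?P = "\<lambda>X Y r. \<exists>w u v. w \<noteq> 0 \<and> X = tvec w u \<and> Y = tvec w v \<and>
     r = Re (hinner u v) / (norm w)^2 - Re (hinner u w * hinner w v) / (norm w)^4"
  have push: "?P (proj_deriv A X) (proj_deriv A Y) r"
    if BA: "B ** A = mat 1" and A: "\<And>u v. hinner (A *v u) (A *v v) = hinner u v" and P: "?P X Y r"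
    for A B :: "'i cmat" and X Y r
  proof -
    from P obtain w u v where w: "w \<noteq> 0" "X = tvec w u" "Y = tvec w v"
      "r = Re (hinner u v) / (norm w)^2 - Re (hinner u w * hinner w v) / (norm w)^4" by blast
    have "(norm (A *v w))\<^sup>2 = (norm w)\<^sup>2" by (simp add: norm_sq_eq_hinner A)
    then have "norm (A *v w) = norm w" by simp
    then show ?thesis
      using w matrix_vector_mult_neq_0[OF BA w(1)]
      by (intro exI[of _ "A *v w"] exI[of _ "A *v u"] exI[of _ "A *v v"]) (simp add: proj_deriv_tvec A)
  qed
  have B: "hinner (B *v u) (B *v v) = hinner u v" for u v
    using A[of "B *v u" "B *v v"] by (simp add: matrix_vector_mul_assoc AB)
  have "?P (proj_deriv A X) (proj_deriv A Y) r \<longleftrightarrow> ?P X Y r" for r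
    using push[OF BA A, of X Y r] push[OF AB B, of "proj_deriv A X" "proj_deriv A Y" r]
    unfolding proj_deriv_inverse[OF BA] by blast
  then show ?thesis unfolding fs_metric_def by presburger
qed

lemma hinner_diag_matrix:
  "(\<And>i. d i * cnj (d i) = 1) \<Longrightarrow> hinner (diag_matrix d *v u) (diag_matrix d *v v) = hinner u v"
  unfolding hinner_def
proof (rule sum.cong)
  fix i assume d: "\<And>i. d i * cnj (d i) = 1"
  have "(diag_matrix d *v u) $ i * cnj ((diag_matrix d *v v) $ i) =
      (d i * cnj (d i)) * (u $ i * cnj (v $ i))"
    by (simp add: diag_matrix_vector_mult)
  then show "(diag_matrix d *v u) $ i * cnj ((diag_matrix d *v v) $ i) = u $ i * cnj (v $ i)"
    by (simp only: d mult_1_left)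
qed simp

text \<open>The differential carries tangent spaces of the fiber and of the \<open>\<T>\<^sub>j\<close>-orbit to those of their images, and
  it is an isometry, so it carries orthogonal complements to orthogonal complements.\<close>

lemma normal_distribution_image:
  fixes A B :: "'i::{finite,linorder} cmat"
  assumes BA: "B ** A = mat 1" and A: "\<And>u v. hinner (A *v u) (A *v v) = hinner u v"
    and orbit: "orbit (PSL_sub (T_j_grp k j)) psl_act (psl_act (psl_class A) p) =
      psl_act (psl_class A) ` orbit (PSL_sub (T_j_grp k j)) psl_act p"
    and orbit_proj: "orbit (PSL_sub (T_j_grp k j)) psl_act p \<subseteq> proj ` (- {0})"
    and F: "F \<subseteq> proj ` (- {0})" and p: "p \<in> proj ` (- {0})"
  shows "normal_distribution k j (psl_act (psl_class A) ` F) (psl_act (psl_class A) p) =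
    proj_deriv A ` normal_distribution k j F p"
  unfolding normal_distribution_def orbit tangent_space_image[OF BA F p]
    tangent_space_image[OF BA orbit_proj p]
  by (auto simp: fs_metric_proj_deriv[OF BA A])


section \<open>Transport of integral manifolds\<close>

text \<open>The charts of a leaf, isolated from the definition of integral manifolds so that their transport can be
  treated on its own.\<close>

definition has_leaf_chart ::
    "('i::finite cvec set \<Rightarrow> ('i cvec \<times> 'i cvec) set set) \<Rightarrow> 'i cvec set topology \<Rightarrow>
      'i cvec set \<Rightarrow> bool" where
  "has_leaf_chart D \<tau> p \<longleftrightarrow> (\<exists>W E S \<psi>.
     openin \<tau> W \<and> p \<in> W \<and> subspace E \<and> open S \<and>
     Cinf_on S \<psi> \<and> (\<forall>x\<in>S. \<psi> x \<noteq> 0) \<and>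
     homeomorphic_map (top_of_set (S \<inter> E)) (subtopology \<tau> W) (proj \<circ> \<psi>) \<and>
     (\<forall>x\<in>S \<inter> E.
        inj_on (\<lambda>v. tvec (\<psi> x) (frechet_derivative \<psi> (at (x::'i cvec)) v)) E \<and>
        (\<lambda>v. tvec (\<psi> x) (frechet_derivative \<psi> (at x) v)) ` E = D (proj (\<psi> x))))"

lemma integral_manifold_altdef:
  "integral_manifold F D L \<longleftrightarrow> L \<subseteq> F \<and> L \<noteq> {} \<and>
     (\<exists>\<tau>. topspace \<tau> = L \<and> connected_space \<tau> \<and> Hausdorff_space \<tau> \<and> second_countable \<tau> \<and>
        (\<forall>p\<in>L. has_leaf_chart D \<tau> p))"
  unfolding integral_manifold_def has_leaf_chart_def ..

text \<open>Composing the lift \<open>\<psi>\<close> of a parametrization with \<open>A\<close> lifts the image parametrization; its derivatives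
  are those of \<open>\<psi>\<close> followed by the injective map \<open>proj_deriv A\<close>.\<close>

lemma has_leaf_chart_image:
  fixes A B :: "'i::finite cmat"
  assumes BA: "B ** A = mat 1"
    and hom: "homeomorphic_map \<tau> \<tau>' (psl_act (psl_class A))"
    and D': "\<And>p. p \<in> topspace \<tau> \<Longrightarrow> D' (psl_act (psl_class A) p) = proj_deriv A ` D p"
    and p: "has_leaf_chart D \<tau> p"
  shows "has_leaf_chart D' \<tau>' (psl_act (psl_class A) p)"
proof -
  let ?f = "psl_act (psl_class A)"
  obtain W E S and \<psi> :: "'i cvec \<Rightarrow> 'i cvec" where W: "openin \<tau> W" "p \<in> W"
    and E: "subspace E" and S: "open S" and \<psi>: "Cinf_on S \<psi>" "\<forall>x\<in>S. \<psi> x \<noteq> 0"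
    and hom\<psi>: "homeomorphic_map (top_of_set (S \<inter> E)) (subtopology \<tau> W) (proj \<circ> \<psi>)"
    and chart: "\<forall>x\<in>S \<inter> E.
        inj_on (\<lambda>v. tvec (\<psi> x) (frechet_derivative \<psi> (at x) v)) E \<and>
        (\<lambda>v. tvec (\<psi> x) (frechet_derivative \<psi> (at x) v)) ` E = D (proj (\<psi> x))"
    using p unfolding has_leaf_chart_def by (elim exE conjE)
  let ?\<psi> = "\<lambda>x. A *v \<psi> x"
  have W_sub: "W \<subseteq> topspace \<tau>" by (rule openin_subset[OF W(1)])
  have top': "topspace \<tau>' = ?f ` topspace \<tau>"
    using homeomorphic_imp_surjective_map[OF hom] ..
  have "homeomorphic_map (subtopology \<tau> W) (subtopology \<tau>' (?f ` W)) ?f"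
    using W_sub top' by (intro homeomorphic_map_subtopologies[OF hom]) auto
  from homeomorphic_map_compose[OF hom\<psi> this]
  have hom': "homeomorphic_map (top_of_set (S \<inter> E)) (subtopology \<tau>' (?f ` W)) (proj \<circ> ?\<psi>)"
    by (simp add: comp_def psl_act_proj)
  have tangent: "inj_on (\<lambda>v. tvec (?\<psi> x) (frechet_derivative ?\<psi> (at x) v)) E \<and>
      (\<lambda>v. tvec (?\<psi> x) (frechet_derivative ?\<psi> (at x) v)) ` E = D' (proj (?\<psi> x))"
    if x: "x \<in> S \<inter> E" for x
  proof -
    let ?d = "\<lambda>v. tvec (\<psi> x) (frechet_derivative \<psi> (at x) v)"
    have "\<psi> differentiable (at x)" using Cinf_on_differentiable[OF \<psi>(1)] x by simp
    then have d': "(\<lambda>v. tvec (?\<psi> x) (frechet_derivative ?\<psi> (at x) v)) = proj_deriv A \<circ> ?d"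
      by (simp add: frechet_derivative_bounded_linear_comp(2)[OF bounded_linear_matrix_vector_mult]
          proj_deriv_tvec comp_def)
    have "inj_on (proj_deriv A) (?d ` E)"
      using proj_deriv_inverse[OF BA] by (rule inj_on_inverseI)
    then have "inj_on (proj_deriv A \<circ> ?d) E"
      using chart x by (intro comp_inj_on) auto
    moreover have "proj (\<psi> x) \<in> topspace \<tau>"
      using homeomorphic_imp_surjective_map[OF hom\<psi>] x by auto
    then have "D' (proj (?\<psi> x)) = proj_deriv A ` D (proj (\<psi> x))"
      using D' by (simp add: psl_act_proj[symmetric])
    then have "(proj_deriv A \<circ> ?d) ` E = D' (proj (?\<psi> x))"
      using chart x unfolding image_comp[symmetric] by simp
    ultimately show ?thesis unfolding d' ..
  qed
  show ?thesis
    unfolding has_leaf_chart_def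
  proof (intro exI conjI ballI)
    show "openin \<tau>' (?f ` W)"
      using homeomorphic_imp_open_map[OF hom] W(1) by (simp add: open_map_def)
    show "?f p \<in> ?f ` W" using W(2) by (rule imageI)
    show "Cinf_on S ?\<psi>" by (rule Cinf_on_matrix_vector_mult[OF S \<psi>(1)])
    show "?\<psi> x \<noteq> 0" if "x \<in> S" for x
      using \<psi>(2) that matrix_vector_mult_neq_0[OF BA] by simp
    show "subspace E" by (rule E)
    fix x assume "x \<in> S \<inter> E"
    from tangent[OF this]
    show "inj_on (\<lambda>v. tvec (?\<psi> x) (frechet_derivative ?\<psi> (at x) v)) E"
      and "(\<lambda>v. tvec (?\<psi> x) (frechet_derivative ?\<psi> (at x) v)) ` E = D' (proj (?\<psi> x))"
      by simp_all
  qed (rule S hom')+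
qed

text \<open>A leaf carries its own topology, which in general is finer than the subspace topology; its push-forward
  along the injective map serves as the topology of the image.\<close>

lemma integral_manifold_image:
  fixes A B :: "'i::finite cmat"
  assumes BA: "B ** A = mat 1" and F: "F \<subseteq> proj ` (- {0})" and L: "integral_manifold F D L"
    and D': "\<And>p. p \<in> F \<Longrightarrow> D' (psl_act (psl_class A) p) = proj_deriv A ` D p"
  shows "integral_manifold (psl_act (psl_class A) ` F) D' (psl_act (psl_class A) ` L)"
proof -
  let ?f = "psl_act (psl_class A)"
  obtain \<tau> where \<tau>: "topspace \<tau> = L" "connected_space \<tau>" "Hausdorff_space \<tau>" "second_countable \<tau>"
    and charts: "\<forall>p\<in>L. has_leaf_chart D \<tau> p" and LF: "L \<subseteq> F" "L \<noteq> {}"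
    using L unfolding integral_manifold_altdef by (elim exE conjE)
  have inj: "inj_on ?f L"
  proof (rule inj_on_inverseI)
    show "psl_act (psl_class B) (?f p) = p" if "p \<in> L" for p
      using that LF F by (intro psl_act_inverse[OF BA]) auto
  qed
  define \<tau>' where "\<tau>' = topology (\<lambda>U. U \<subseteq> ?f ` topspace \<tau> \<and> openin \<tau> {p \<in> topspace \<tau>. ?f p \<in> U})"
  have hom: "homeomorphic_map \<tau> \<tau>' ?f"
    unfolding homeomorphic_map_def \<tau>'_def
    using quotient_map_quotient_topology[of \<tau> ?f] inj \<tau>(1) by simp
  then have top': "topspace \<tau>' = ?f ` L"
    using homeomorphic_imp_surjective_map[OF hom] \<tau>(1) by simp
  have space: "\<tau> homeomorphic_space \<tau>'" using hom by (rule homeomorphic_map_imp_homeomorphic_space)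
  show ?thesis
    unfolding integral_manifold_altdef
  proof (intro conjI exI ballI)
    show "connected_space \<tau>'" "Hausdorff_space \<tau>'" "second_countable \<tau>'"
      using \<tau>(2-4) homeomorphic_connected_space[OF space] homeomorphic_Hausdorff_space[OF space]
        homeomorphic_space_second_countability[OF space] by simp_all
    show "has_leaf_chart D' \<tau>' q" if "q \<in> ?f ` L" for q
    proof -
      obtain p where p: "p \<in> L" "q = ?f p" using \<open>q \<in> ?f ` L\<close> by (elim imageE)
      show ?thesis
        unfolding p(2) using charts p(1) LF(1) \<tau>(1)
        by (intro has_leaf_chart_image[where D = D, OF BA hom D']) auto
    qed
  qed (use LF top' in auto)
qed

lemma integral_manifold_subset: "integral_manifold F D L \<Longrightarrow> L \<subseteq> F"
  by (simp add: integral_manifold_def)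

lemma psl_act_image_subset:
  fixes A B :: "'i::finite cmat"
  assumes "B ** A = mat 1" and "F \<subseteq> proj ` (- {0})"
  shows "psl_act (psl_class A) ` F \<subseteq> proj ` (- {0})"
proof (rule image_subsetI)
  fix p assume "p \<in> F"
  then obtain w where "p = proj w" "w \<noteq> 0" using assms(2) by auto
  then show "psl_act (psl_class A) p \<in> proj ` (- {0})"
    using matrix_vector_mult_neq_0[OF assms(1)] by (simp add: psl_act_proj)
qed

text \<open>The hypothesis relating \<open>D\<close> and \<open>D'\<close> is symmetric in the two inverse matrices, so every transport
  lemma can be applied in both directions.\<close>

lemma distribution_inverse:
  fixes A B :: "'i::finite cmat"
  assumes BA: "B ** A = mat 1" and F: "F \<subseteq> proj ` (- {0})"
    and D': "\<And>p. p \<in> F \<Longrightarrow> D' (psl_act (psl_class A) p) = proj_deriv A ` D p"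
    and q: "q \<in> psl_act (psl_class A) ` F"
  shows "D (psl_act (psl_class B) q) = proj_deriv B ` D' q"
proof -
  obtain p where p: "p \<in> F" "q = psl_act (psl_class A) p" using q by blast
  then have "psl_act (psl_class B) q = p"
    unfolding p(2) using F by (intro psl_act_inverse[OF BA]) auto
  then show ?thesis using D'[OF p(1)] p(2) by (simp add: image_image proj_deriv_inverse[OF BA])
qed

lemma integral_foliation_subset: "L \<in> integral_foliation F D \<Longrightarrow> L \<subseteq> F"
  by (simp add: integral_foliation_def integral_manifold_def)

text \<open>An integral manifold larger than the image of a leaf is mapped by the inverse to one larger than the leaf,
  so maximality carries over.\<close>

lemma integral_foliation_image_subset:
  fixes A B :: "'i::finite cmat"
  assumes BA: "B ** A = mat 1" and F: "F \<subseteq> proj ` (- {0})"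
    and D': "\<And>p. p \<in> F \<Longrightarrow> D' (psl_act (psl_class A) p) = proj_deriv A ` D p"
    and L: "L \<in> integral_foliation F D"
  shows "psl_act (psl_class A) ` L \<in> integral_foliation (psl_act (psl_class A) ` F) D'"
proof -
  let ?f = "psl_act (psl_class A)" and ?g = "psl_act (psl_class B)"
  have AB: "A ** B = mat 1" using BA by (simp add: matrix_left_right_inverse)
  have LF: "L \<subseteq> F" by (rule integral_foliation_subset[OF L])
  note fF = psl_act_image_subset[OF BA F] and D = distribution_inverse[where D = D and D' = D', OF BA F D']
  have "L' = ?f ` L" if L': "integral_manifold (?f ` F) D' L'" and sub: "?f ` L \<subseteq> L'" for L'
  proof -
    have "integral_manifold F D (?g ` L')"
      using integral_manifold_image[where D = D' and D' = D, OF AB fF L' D] psl_act_image_inverse[OF BA F] by simp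
    moreover have "L \<subseteq> ?g ` L'"
      using image_mono[OF sub, of ?g] psl_act_image_inverse[OF BA, of L] LF F by simp
    ultimately have "?g ` L' = L" using L by (auto simp: integral_foliation_def)
    moreover have "L' \<subseteq> proj ` (- {0})" using integral_manifold_subset[OF L'] fF by blast
    ultimately show ?thesis using psl_act_image_inverse[OF AB, of L'] by simp
  qed
  moreover have "integral_manifold (?f ` F) D' (?f ` L)"
    using L integral_manifold_image[where D = D and D' = D', OF BA F _ D']
    by (simp add: integral_foliation_def)
  ultimately show ?thesis by (auto simp: integral_foliation_def)
qed

lemma integral_foliation_image:
  fixes A B :: "'i::finite cmat"
  assumes BA: "B ** A = mat 1" and F: "F \<subseteq> proj ` (- {0})"
    and D': "\<And>p. p \<in> F \<Longrightarrow> D' (psl_act (psl_class A) p) = proj_deriv A ` D p"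
  shows "(\<lambda>L. psl_act (psl_class A) ` L) ` integral_foliation F D =
    integral_foliation (psl_act (psl_class A) ` F) D'"
proof (intro equalityI image_subsetI subsetI)
  let ?f = "psl_act (psl_class A)" and ?g = "psl_act (psl_class B)"
  fix L' assume L': "L' \<in> integral_foliation (?f ` F) D'"
  have AB: "A ** B = mat 1" using BA by (simp add: matrix_left_right_inverse)
  note fF = psl_act_image_subset[OF BA F] and D = distribution_inverse[where D = D and D' = D', OF BA F D']
  have "?g ` L' \<in> integral_foliation F D"
    using integral_foliation_image_subset[where D = D' and D' = D, OF AB fF D L'] psl_act_image_inverse[OF BA F] by simp
  moreover have "L' \<subseteq> ?f ` F" by (rule integral_foliation_subset[OF L'])
  then have "L' = ?f ` ?g ` L'"
    using fF psl_act_image_inverse[OF AB, of L'] by simp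
  ultimately show "L' \<in> (\<lambda>L. ?f ` L) ` integral_foliation F D" by blast
qed (rule integral_foliation_image_subset[where D = D and D' = D', OF BA F D'])

lemma normal_foliation_image:
  fixes h :: "'i::{finite,linorder} cmat set"
  assumes T: "T_j_grp k j \<subseteq> (diag_classes :: 'i cmat set set)" and h: "h \<in> T_grp"
    and F: "F \<subseteq> V_set k j"
  shows "(\<lambda>L. psl_act h ` L) ` normal_foliation k j F = normal_foliation k j (psl_act h ` F)"
proof -
  obtain d where d: "h = psl_class (diag_matrix d)" "\<And>i. d i * cnj (d i) = 1"
    using T_grp_unitary[OF h] by blast
  then have nz: "d i \<noteq> 0" for i by (metis mult_zero_left zero_neq_one)
  then have h_diag: "h \<in> diag_classes" using d(1) by (auto simp: diag_classes_def)
  note inv = diag_matrix_inverse(1)[of d, OF nz]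
  have F': "F \<subseteq> proj ` (- {0})" using F V_set_subset by blast
  have "normal_distribution k j (psl_act h ` F) (psl_act h p) =
      proj_deriv (diag_matrix d) ` normal_distribution k j F p" if p: "p \<in> F" for p
    unfolding d(1)
  proof (rule normal_distribution_image[OF inv])
    show "orbit (PSL_sub (T_j_grp k j)) psl_act (psl_act (psl_class (diag_matrix d)) p) =
      psl_act (psl_class (diag_matrix d)) ` orbit (PSL_sub (T_j_grp k j)) psl_act p"
      using orbit_psl_act_diag[OF T h_diag] d(1) by simp
    have "psl_act g p \<in> V_set k j" if "g \<in> T_j_grp k j" for g
      using that T p F psl_act_V_set by blast
    then show "orbit (PSL_sub (T_j_grp k j)) psl_act p \<subseteq> proj ` (- {0})"
      using V_set_subset[of k j] by (auto simp: orbit_def)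
    show "hinner (diag_matrix d *v u) (diag_matrix d *v v) = hinner u v" for u v
      by (rule hinner_diag_matrix[OF d(2)])
  qed (use p F' in auto)
  then show ?thesis
    unfolding normal_foliation_def d(1) by (intro integral_foliation_image[OF inv F']) simp
qed

section \<open>The action of \<open>H\<^sub>j\<close> on the bundle and on the Lagrangian frames\<close>

theorem theorem5p9:
  fixes k :: "nat list" and n j :: nat
  assumes "CARD('i::{finite,linorder}) = n + 1"
    and "is_partition k n"
    and "j \<le> length k"
  shows "group_action (PSL_sub (H_grp k j)) (V_set k j :: 'i cvec set set)
           (\<lambda>h. restrict (psl_act h) (V_set k j)) \<and>
    (\<exists>\<alpha>. group_action (PSL_sub (H_grp k j)) (base_set k j :: 'i cvec set set set) \<alpha> \<and>
       (\<forall>h\<in>H_grp k j. \<forall>p\<in>V_set k j.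
          \<alpha> h (bundle_proj k j p) = bundle_proj k j (psl_act h p)) \<and>
       (\<forall>h\<in>H_grp k j.
          principal_bundle_automorphism (V_space k j) (base_space k j) (bundle_proj k j)
            (G_grp k j) psl_act (psl_act h) (\<alpha> h))) \<and>
    (\<forall>h\<in>H_grp k j. \<forall>F\<in>fibers k j :: 'i cvec set set set.
       psl_act h ` F \<in> fibers k j) \<and>
    (\<forall>h\<in>H_grp k j \<inter> T_grp. \<forall>F\<in>fibers k j :: 'i cvec set set set.
       (\<lambda>L. psl_act h ` L) ` orbit_foliation k j F = orbit_foliation k j (psl_act h ` F) \<and>
       (\<lambda>L. psl_act h ` L) ` normal_foliation k j F = normal_foliation k j (psl_act h ` F))"
proof -
  have block: "block k i \<le> length k" for i :: 'i
    using assms by (intro block_le_length) (auto simp: is_partition_def)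
  note G = G_grp_subset_diag_classes[OF block]
  have T: "T_j_grp k j \<subseteq> (diag_classes :: 'i cmat set set)" using G by (auto simp: T_j_grp_def)
  have H: "h \<in> diag_classes" if "h \<in> H_grp k j" for h :: "'i cmat set"
    using that H_grp_subset_diag_classes[OF block] by blast
  note group = group_H_grp[OF block, of j]
  \<comment> \<open>A point of the base is an orbit, so \<open>h\<close> acts on the base through images; restriction to the base
    makes the map extensional, as permutations in \<open>BijGroup\<close> have to be.\<close>
  let ?\<alpha> = "\<lambda>h. restrict ((`) (psl_act h)) (base_set k j :: 'i cvec set set set)"
  have carrier: "carrier (PSL_sub (H_grp k j :: 'i cmat set set)) = H_grp k j" by simp
  have act_mult: "psl_act (g \<otimes>\<^bsub>PSL_sub (H_grp k j)\<^esub> h) p = psl_act g (psl_act h p)"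
    if "g \<in> H_grp k j" "h \<in> H_grp k j" for g h and p :: "'i cvec set"
    using that by (auto simp: PSL_def H_grp_altdef psl_class_mult psl_act_psl_class_mult)
  have act_one: "psl_act \<one>\<^bsub>PSL_sub (H_grp k j)\<^esub> p = p" if "p \<in> V_set k j" for p :: "'i cvec set"
    using that V_set_subset by (auto simp: PSL_def SL_center_eq_psl_class psl_act_proj V_set_def)
  have act_closed: "psl_act h p \<in> V_set k j" if "h \<in> H_grp k j" "p \<in> V_set k j" for h and p :: "'i cvec set"
    using psl_act_V_set[OF H[OF that(1)] that(2)] .
  have act_V: "group_action (PSL_sub (H_grp k j)) (V_set k j :: 'i cvec set set)
      (\<lambda>h. restrict (psl_act h) (V_set k j))"
    by (rule group_action_restrictI[OF group]) (simp_all only: carrier act_closed act_mult act_one)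
  have act_base: "group_action (PSL_sub (H_grp k j)) (base_set k j :: 'i cvec set set set) ?\<alpha>"
  proof (rule group_action_restrictI[OF group])
    show "psl_act h ` b \<in> base_set k j"
      if "h \<in> carrier (PSL_sub (H_grp k j))" "b \<in> base_set k j" for h and b :: "'i cvec set set"
      using image_base_set[OF G H that(2)] that(1) unfolding carrier .
    show "psl_act (g \<otimes>\<^bsub>PSL_sub (H_grp k j)\<^esub> h) ` b = psl_act g ` psl_act h ` b"
      if "g \<in> carrier (PSL_sub (H_grp k j))" "h \<in> carrier (PSL_sub (H_grp k j))"
      for g h and b :: "'i cvec set set"
      using that unfolding carrier image_image by (intro image_cong refl act_mult)
    show "psl_act \<one>\<^bsub>PSL_sub (H_grp k j)\<^esub> ` b = b" if "b \<in> base_set k j" for b :: "'i cvec set set"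
    proof -
      have "psl_act \<one>\<^bsub>PSL_sub (H_grp k j)\<^esub> p = p" if "p \<in> b" for p
        using that base_set_subset[OF G \<open>b \<in> base_set k j\<close>] act_one by blast
      then show ?thesis by simp
    qed
  qed
  have descends: "?\<alpha> h (bundle_proj k j p) = bundle_proj k j (psl_act h p)"
    if "h \<in> H_grp k j" "p \<in> V_set k j" for h p
    using that bundle_proj_psl_act[OF G H] by (simp add: base_set_altdef)
  have frames: "(\<lambda>L. psl_act h ` L) ` orbit_foliation k j F = orbit_foliation k j (psl_act h ` F)"
      "(\<lambda>L. psl_act h ` L) ` normal_foliation k j F = normal_foliation k j (psl_act h ` F)"
    if "h \<in> H_grp k j \<inter> T_grp" "F \<in> fibers k j" for h and F :: "'i cvec set set"
  proof -
    have "F \<subseteq> V_set k j" using that by (auto simp: fibers_def)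
    with that show "(\<lambda>L. psl_act h ` L) ` orbit_foliation k j F = orbit_foliation k j (psl_act h ` F)"
      "(\<lambda>L. psl_act h ` L) ` normal_foliation k j F = normal_foliation k j (psl_act h ` F)"
      using orbit_foliation_image[OF T H] normal_foliation_image[OF T] by simp_all
  qed
  show ?thesis
    by (intro conjI exI[of _ ?\<alpha>] ballI act_V act_base descends frames
        principal_bundle_automorphism_diag[OF G H] image_fibers[OF G H])
qed

end
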